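(* (1) Let $a,b,c$ be real numbers with $0<a<1$, $0<b<1$ and $c\ge 1+a+b-ab$. Then the shifted hypergeometric function $z\,{}_2F_1(a,b;c;z)$ is convex in $\mathbb D$. (2) Let $a,b,c$ be real numbers with $0<a<1<b\le c$. Then $z\,{}_2F_1(a,b;c;z)$ is not convex in $\mathbb D$ if one of the following conditions holds: (a) $ab<1$ and $c<a+b$; (b) $ab>1$ and $c<\min\left\{1+a+b-ab,\ \dfrac{3+\sqrt{9+4(a^2+b^2-3a-3b+2)}}{2}\right\}$.
   Context: $\mathbb D=\{z\in\mathbb C:|z|<1\}$. For real $a,b,c$ with $c\ne 0,-1,-2,\dots$, ${}_2F_1(a,b;c;z)=\sum_{n=0}^\infty \frac{(a)_n(b)_n}{(c)_n n!}z^n$ for $z\in\mathbb D$, where $(a)_0=1$ and $(a)_n=a(a+1)\cdots(a+n-1)$. A function $f$ analytic in $\mathbb D$ with $f(0)=0$, $f'(0)=1$ is called convex if it is univalent in $\mathbb D$ and $f(\mathbb D)$ is a convex domain; equivalently, $f'$ has no zeros in $\mathbb D$ and $1+\inf_{z\in\mathbb D}\operatorname{Re}\frac{zf''(z)}{f'(z)}\ge 0$. *)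

theory Defs
  imports "HOL-Analysis.Analysis" "HOL-Real_Asymp.Real_Asymp"
begin

definition hyp2f1 :: "real \<Rightarrow> real \<Rightarrow> real \<Rightarrow> complex \<Rightarrow> complex" where
  "hyp2f1 a b c z = eval_fps (fps_hypergeo [of_real a, of_real b] [of_real c] 1) z"

lemma hyp2f1_series:
  "hyp2f1 a b c z =
     (\<Sum>n. of_real (pochhammer a n * pochhammer b n / (pochhammer c n * fact n)) * z ^ n)"
  by (simp add: hyp2f1_def eval_fps_def pochhammer_of_real)

definition shifted_hyp2f1 :: "real \<Rightarrow> real \<Rightarrow> real \<Rightarrow> complex \<Rightarrow> complex" where
  "shifted_hyp2f1 a b c z = z * hyp2f1 a b c z"

definition normalized_analytic :: "(complex \<Rightarrow> complex) \<Rightarrow> bool" where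
  "normalized_analytic f \<longleftrightarrow> f holomorphic_on ball 0 1 \<and> f 0 = 0 \<and> deriv f 0 = 1"

definition convex_function :: "(complex \<Rightarrow> complex) \<Rightarrow> bool" where
  "convex_function f \<longleftrightarrow> normalized_analytic f \<and> inj_on f (ball 0 1) \<and>
     open (f ` ball 0 1) \<and> connected (f ` ball 0 1) \<and> convex (f ` ball 0 1)"

text \<open>
  A shifted hypergeometric function with positive parameters is always analytic and normalized,
  so it can fail to be a convex function only through univalence or the geometry of its image.
\<close>

lemma normalized_analytic_shifted_hyp2f1:
  assumes "a > 0" "b > 0" "c > 0"
  shows "normalized_analytic (shifted_hyp2f1 a b c)"
proof -
  define F :: "complex fps" where "F = fps_hypergeo [of_real a, of_real b] [of_real c] 1"
  have nth: "fps_nth F n =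
      of_real (pochhammer a n * pochhammer b n / (pochhammer c n * fact n))" for n
    by (simp add: F_def pochhammer_of_real)
  have pos: "pochhammer a n > 0" "pochhammer b n > 0" "pochhammer c n > 0" for n
    using assms by (simp_all add: pochhammer_pos)
  have nz: "fps_nth F n \<noteq> 0" for n
    unfolding nth of_real_eq_0_iff using pos[of n] by simp
  have ratio: "norm (fps_nth F n) / norm (fps_nth F (Suc n)) =
      (c + real n) * (1 + real n) / ((a + real n) * (b + real n))" for n
    using pos[of n] assms
    by (simp only: nth norm_of_real)
       (simp add: pochhammer_Suc abs_mult divide_simps add_pos_nonneg add_ac mult_ac)
  have "(\<lambda>n. (c + real n) * (1 + real n) / ((a + real n) * (b + real n))) \<longlonglongrightarrow> 1"
    by real_asymp
  then have "fps_conv_radius F = 1"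
    unfolding fps_conv_radius_def
    by (intro conv_radius_ratio_limit_nonzero[of _ 1]) (use nz in \<open>simp_all add: ratio\<close>)
  then have hol: "eval_fps F holomorphic_on ball 0 1"
    by (intro holomorphic_intros) (auto simp: eball_def dist_norm)
  have eq: "shifted_hyp2f1 a b c = (\<lambda>z. z * eval_fps F z)"
    by (simp add: fun_eq_iff shifted_hyp2f1_def hyp2f1_def F_def)
  have "eval_fps F field_differentiable at 0"
    using hol by (simp add: holomorphic_on_imp_differentiable_at)
  then have "((\<lambda>z. z * eval_fps F z) has_field_derivative
      0 * deriv (eval_fps F) 0 + 1 * eval_fps F 0) (at 0)"
    by (auto intro!: derivative_eq_intros field_differentiable_derivI simp: field_differentiable_derivI)
  moreover have "eval_fps F 0 = 1"
    by (simp add: eval_fps_at_0 F_def)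
  ultimately have "deriv (\<lambda>z. z * eval_fps F z) 0 = 1"
    by (auto intro: DERIV_imp_deriv)
  with hol show ?thesis
    unfolding normalized_analytic_def eq by (auto intro!: holomorphic_intros)
qed

end

theory Submission
  imports Defs "HOL-Complex_Analysis.Complex_Analysis"
begin

text \<open>
  Write \<open>F\<close> for the hypergeometric series, \<open>f z = z F(z)\<close> and
  \<open>R(z) = 1 + z f''(z) / f'(z)\<close>. On every circle around 0, \<open>Re R\<close> is the rate at which the tangent of the
  image curve turns, so both parts are statements about the sign of \<open>Re R\<close>:
  \<open>Re R > 0\<close> makes \<open>f\<close> injective with convex image (\<open>injective_if_curvature_pos\<close>,
  \<open>convex_image_if_curvature_pos\<close>), and an injective \<open>f\<close> with convex image has \<open>Re R \<ge> 0\<close>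
  (\<open>convex_imp_curvature_nonneg\<close>).

  Put \<open>q = F' / f'\<close> and \<open>\<delta> = c - 1 - a - b + a b\<close>. The hypergeometric differential equation turns \<open>R\<close> into
  \<open>R = 1 + (1 - a) (1 - b) z q + z / (1 - z) (a b - \<delta> q)\<close>,
  and the hypothesis of the first part says \<open>\<delta> \<ge> 0\<close>. Since \<open>z / (1 - z) = ((1 + z) / (1 - z) - 1) / 2\<close>,
  it remains to see that \<open>\<bar>z q\<bar> \<le> 1\<close>, \<open>\<delta> \<bar>q\<bar> \<le> a b\<close> and
  \<open>Re ((1 + z) / (1 - z) (a b - \<delta> q)) \<ge> 0\<close>, which give \<open>Re R \<ge> a (1 - b) + b (1 - a) > 0\<close>.
  All three rest on Gauss' continued fraction for a quotient of contiguous series, whose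
  coefficients are positive. It makes the power series coefficients of \<open>q\<close> nonnegative
  (\<open>deriv_quotient_nonneg\<close>), so that the two norm bounds need only be checked on \<open>[0, 1)\<close>, and it makes
  \<open>q\<close> map the upper half of the disc into the upper half-plane (\<open>deriv_quotient_Pick\<close>). On the unit
  circle \<open>(1 + z) / (1 - z)\<close> is purely imaginary, so the third inequality is the second property
  on the boundary (\<open>Re_Cayley_Pick_nonneg\<close>).

  In the second part \<open>0 < s\<close> for \<open>s = a + b - c\<close>, and \<open>F\<close> tends to infinity at 1 with
  \<open>(1 - x) F'(x) / F(x)\<close> tending to \<open>s\<close> (\<open>hyp_boundary_behaviour\<close>). Hence
  \<open>R(x) = (1 + s) / 2 * (1 + x) / (1 - x) + \<kappa> + o(1)\<close> for an explicit constant \<open>\<kappa>\<close>. If \<open>Re R \<ge> 0\<close>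
  on the disc, Julia's lemma forbids \<open>\<kappa> < 0\<close> (\<open>convex_imp_angular_constant_nonneg\<close>). But
  \<open>2 s \<kappa> = c\<^sup>2 - 3 c - (a\<^sup>2 + b\<^sup>2 - 3 a - 3 b + 2)\<close>, and either of the two conditions makes this
  negative.
\<close>

section \<open>Power series with real coefficients on the unit disc\<close>

text \<open>
  Coefficients are kept real, because their signs and their sizes are what the argument uses; the
  analytic functions are the values of the complex series with the same coefficients.
\<close>

definition cfps :: "real fps \<Rightarrow> complex fps"
  where "cfps P = Abs_fps (\<lambda>n. complex_of_real (fps_nth P n))"

lemma cfps_nth [simp]: "fps_nth (cfps P) n = complex_of_real (fps_nth P n)"
  by (simp add: cfps_def)

lemma cfps_simps [simp]:
  "cfps (P + Q) = cfps P + cfps Q"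
  "cfps (P - Q) = cfps P - cfps Q"
  "cfps (P * Q) = cfps P * cfps Q"
  "cfps (fps_const x) = fps_const (complex_of_real x)"
  "cfps fps_X = fps_X"
  "cfps 1 = 1"
  "cfps (fps_deriv P) = fps_deriv (cfps P)"
  by (simp_all add: fps_eq_iff fps_mult_nth fps_X_def)

lemma fps_conv_radius_cfps [simp]: "fps_conv_radius (cfps P) = fps_conv_radius P"
  by (simp add: fps_conv_radius_def conv_radius_def)

lemma eval_cfps_of_real:
  assumes "ereal \<bar>x\<bar> < fps_conv_radius P"
  shows "eval_fps (cfps P) (complex_of_real x) = complex_of_real (eval_fps P x)"
proof -
  have "(\<lambda>n. fps_nth P n * x ^ n) sums eval_fps P x"
    using assms by (intro sums_eval_fps) simp
  then have "(\<lambda>n. complex_of_real (fps_nth P n * x ^ n)) sums complex_of_real (eval_fps P x)"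
    by (rule sums_of_real)
  then show ?thesis
    by (simp add: eval_fps_def sums_iff)
qed

lemma norm_eval_cfps_le:
  assumes "\<And>n. fps_nth P n \<ge> 0" "ereal (norm z) < fps_conv_radius P"
  shows "norm (eval_fps (cfps P) z) \<le> eval_fps P (norm z)"
proof -
  have "(\<lambda>n. fps_nth P n * norm z ^ n) sums eval_fps P (norm z)"
    using assms by (intro sums_eval_fps) simp
  moreover have "norm (fps_nth (cfps P) n * z ^ n) = fps_nth P n * norm z ^ n" for n
    using assms(1)[of n] by (simp add: norm_mult norm_power)
  ultimately show ?thesis
    unfolding eval_fps_def[of "cfps P"] sums_iff
    using summable_norm[of "\<lambda>n. fps_nth (cfps P) n * z ^ n"] by simp
qed

definition disc_conv :: "real fps \<Rightarrow> bool"
  where "disc_conv P \<longleftrightarrow> fps_conv_radius P \<ge> 1"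

lemma disc_conv_less:
  assumes "disc_conv P" "norm z < 1"
  shows "ereal (norm z) < fps_conv_radius P"
  by (rule less_le_trans[of _ 1]) (use assms in \<open>auto simp: disc_conv_def\<close>)

lemma disc_conv_intros [simp, intro]:
  "disc_conv P \<Longrightarrow> disc_conv Q \<Longrightarrow> disc_conv (P + Q)"
  "disc_conv P \<Longrightarrow> disc_conv Q \<Longrightarrow> disc_conv (P - Q)"
  "disc_conv P \<Longrightarrow> disc_conv Q \<Longrightarrow> disc_conv (P * Q)"
  "disc_conv P \<Longrightarrow> disc_conv (fps_deriv P)"
  "disc_conv (fps_const x)" "disc_conv fps_X" "disc_conv 1"
  using fps_conv_radius_add[of P Q] fps_conv_radius_diff[of P Q] fps_conv_radius_mult[of P Q]
    fps_conv_radius_deriv[of P]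
  by (auto simp: disc_conv_def intro: order_trans min.boundedI)

lemma disc_conv_mono:
  fixes P Q :: "real fps"
  assumes "\<And>n. fps_nth P n \<ge> 0" "\<And>n. fps_nth P n \<le> fps_nth Q n" "disc_conv Q"
  shows "disc_conv P"
proof -
  have "conv_radius (fps_nth Q) \<le> conv_radius (fps_nth P)"
  proof (rule conv_radius_geI_ex)
    fix r :: real assume r: "0 < r" "ereal r < conv_radius (fps_nth Q)"
    have "summable (\<lambda>n. fps_nth Q n * r ^ n)"
      using r by (intro summable_in_conv_radius) auto
    then have "summable (\<lambda>n. fps_nth P n * r ^ n)"
      by (rule summable_comparison_test') (use assms r in \<open>auto simp: abs_mult intro!: mult_right_mono\<close>)
    then show "\<exists>z. norm z = r \<and> summable (\<lambda>n. fps_nth P n * z ^ n)"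
      using r by (intro exI[of _ r]) auto
  qed
  with assms(3) show ?thesis
    by (simp add: disc_conv_def fps_conv_radius_def)
qed

lemma eval_fps_nonneg:
  fixes P :: "real fps"
  assumes "\<And>n. fps_nth P n \<ge> 0" "x \<ge> 0" "ereal x < fps_conv_radius P"
  shows "eval_fps P x \<ge> 0"
  unfolding eval_fps_def using assms by (intro suminf_nonneg summable_fps) auto

lemma eval_cfps:
  assumes "norm z < 1"
  shows "disc_conv P \<Longrightarrow> disc_conv Q \<Longrightarrow> eval_fps (cfps (P + Q)) z = eval_fps (cfps P) z + eval_fps (cfps Q) z"
    "disc_conv P \<Longrightarrow> disc_conv Q \<Longrightarrow> eval_fps (cfps (P - Q)) z = eval_fps (cfps P) z - eval_fps (cfps Q) z"
    "disc_conv P \<Longrightarrow> disc_conv Q \<Longrightarrow> eval_fps (cfps (P * Q)) z = eval_fps (cfps P) z * eval_fps (cfps Q) z"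
    "eval_fps (cfps (fps_const x)) z = of_real x" "eval_fps (cfps fps_X) z = z" "eval_fps (cfps 1) z = 1"
  using assms by (simp_all add: eval_fps_add eval_fps_diff eval_fps_mult disc_conv_less)

lemma eval_cfps_real:
  assumes "disc_conv P" "\<bar>x\<bar> < 1"
  shows "eval_fps (cfps P) (of_real x) = of_real (eval_fps P x)"
  using assms disc_conv_less[of P x] by (intro eval_cfps_of_real) auto

lemma DERIV_eval_cfps:
  assumes "disc_conv P" "norm z < 1"
  shows "(eval_fps (cfps P) has_field_derivative eval_fps (cfps (fps_deriv P)) z) (at z)"
  using has_field_derivative_eval_fps[of z "cfps P"] disc_conv_less[OF assms] by simp

lemma holomorphic_eval_cfps: "disc_conv P \<Longrightarrow> eval_fps (cfps P) holomorphic_on ball 0 1"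
  using disc_conv_less[of P] by (intro holomorphic_intros) auto

lemma eval_cfps_cnj: "eval_fps (cfps P) (cnj z) = cnj (eval_fps (cfps P) z)" if "disc_conv P" "norm z < 1"
proof -
  have "(\<lambda>n. fps_nth (cfps P) n * z ^ n) sums eval_fps (cfps P) z"
    using disc_conv_less[OF that] by (intro sums_eval_fps) simp
  then have "(\<lambda>n. cnj (fps_nth (cfps P) n * z ^ n)) sums cnj (eval_fps (cfps P) z)"
    by (simp only: sums_cnj)
  then show ?thesis by (simp add: eval_fps_def sums_iff)
qed

lemma eval_fps_ge_nth_0:
  fixes P :: "real fps"
  assumes "\<And>n. fps_nth P n \<ge> 0" "disc_conv P" "0 \<le> x" "x < 1"
  shows "eval_fps P x \<ge> fps_nth P 0"
proof -
  have "summable (\<lambda>n. fps_nth P n * x ^ n)"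
    using assms disc_conv_less[of P x] by (intro summable_fps) auto
  from sum_le_suminf[OF this, of "{0}"] assms show ?thesis
    by (simp add: eval_fps_def)
qed

lemma eval_disc_conv_real:
  fixes P Q :: "real fps" and x :: real
  assumes "\<bar>x\<bar> < 1" "disc_conv P" "disc_conv Q"
  shows "eval_fps (P + Q) x = eval_fps P x + eval_fps Q x"
    "eval_fps (P - Q) x = eval_fps P x - eval_fps Q x"
    "eval_fps (P * Q) x = eval_fps P x * eval_fps Q x"
proof -
  have "ereal (norm x) < fps_conv_radius P" "ereal (norm x) < fps_conv_radius Q"
    using disc_conv_less[OF assms(2), of x] disc_conv_less[OF assms(3), of x] assms(1)
    by simp_all
  then show "eval_fps (P + Q) x = eval_fps P x + eval_fps Q x"
    "eval_fps (P - Q) x = eval_fps P x - eval_fps Q x"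
    "eval_fps (P * Q) x = eval_fps P x * eval_fps Q x"
    by (simp_all only: eval_fps_add eval_fps_diff eval_fps_mult)
qed

section \<open>Contiguous hypergeometric series\<close>

abbreviation hyp :: "real \<Rightarrow> real \<Rightarrow> real \<Rightarrow> real fps"
  where "hyp a b c \<equiv> fps_hypergeo [a, b] [c] 1"

lemma fact_Suc_real: "fact (Suc n) = (1 + real n) * fact n" "1 + real n \<noteq> 0"
  by (simp_all add: field_simps)

lemma hyp_commute: "hyp a b c = hyp b a c"
  by (simp add: fps_eq_iff mult_ac)

lemma hyp_Suc:
  assumes "c > 0"
  shows "(c + real n) * (1 + real n) * fps_nth (hyp a b c) (Suc n) =
         (a + real n) * (b + real n) * fps_nth (hyp a b c) n"
  using pochhammer_pos[OF assms, of n] assms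
  by (simp add: pochhammer_Suc fact_Suc_real add_pos_nonneg divide_simps del: fact_Suc of_nat_Suc)

lemma hyp_pos:
  assumes "a > 0" "b > 0" "c > 0"
  shows "fps_nth (hyp a b c) n > 0"
  using assms by (simp add: pochhammer_pos)

lemma hyp_conv_radius:
  assumes "a > 0" "b > 0" "c > 0"
  shows "fps_conv_radius (hyp a b c) = 1"
proof -
  note [simp del] = fps_hypergeo_nth
  have nz: "fps_nth (hyp a b c) n \<noteq> 0" for n
    using hyp_pos[OF assms, of n] by simp
  have "norm (fps_nth (hyp a b c) n) / norm (fps_nth (hyp a b c) (Suc n)) =
      (c + real n) * (1 + real n) / ((a + real n) * (b + real n))" for n
    using hyp_Suc[OF assms(3), of n a b] hyp_pos[OF assms, of n] hyp_pos[OF assms, of "Suc n"] assms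
    by (simp add: divide_simps add_pos_nonneg mult_ac del: fps_hypergeo_nth)
  moreover have "(\<lambda>n. (c + real n) * (1 + real n) / ((a + real n) * (b + real n))) \<longlonglongrightarrow> 1"
    by real_asymp
  ultimately show ?thesis
    unfolding fps_conv_radius_def
    by (intro conv_radius_ratio_limit_nonzero[of _ 1]) (use nz in simp_all)
qed

lemma disc_conv_hyp: "a > 0 \<Longrightarrow> b > 0 \<Longrightarrow> c > 0 \<Longrightarrow> disc_conv (hyp a b c)"
  by (simp add: disc_conv_def hyp_conv_radius)

lemma fps_deriv_hyp:
  "fps_deriv (hyp a b c) = fps_const (a * b / c) * hyp (a + 1) (b + 1) (c + 1)"
  by (simp add: fps_eq_iff pochhammer_rec divide_simps fact_Suc_real add.commute
        del: fact_Suc of_nat_Suc) (simp add: algebra_simps)?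

lemma hyp_contiguous_upper:
  assumes "c > 0"
  shows "hyp (a + 1) b c = hyp a b c + fps_const (b / c) * fps_X * hyp (a + 1) (b + 1) (c + 1)"
proof (rule fps_ext)
  fix n
  show "fps_nth (hyp (a + 1) b c) n =
        fps_nth (hyp a b c + fps_const (b / c) * fps_X * hyp (a + 1) (b + 1) (c + 1)) n"
  proof (cases n)
    case (Suc m)
    define P Q R where "P = pochhammer (a + 1) m" and "Q = pochhammer (b + 1) m"
      and "R = pochhammer (c + 1) m"
    have "R > 0" using assms by (simp add: R_def pochhammer_pos)
    moreover have "pochhammer a (Suc m) = a * P" "pochhammer b (Suc m) = b * Q" "pochhammer c (Suc m) = c * R"
      by (simp_all add: P_def Q_def R_def pochhammer_rec)
    moreover have "pochhammer (a + 1) (Suc m) = (a + 1 + real m) * P"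
      unfolding P_def by (rule pochhammer_rec')
    ultimately show ?thesis
      using assms Suc
      by (simp add: mult.assoc fps_mult_left_const_nth P_def [symmetric] Q_def [symmetric]
            R_def [symmetric] fact_Suc_real divide_simps del: fact_Suc of_nat_Suc) (simp add: algebra_simps)
  qed simp
qed

text \<open>
  The coefficient in Gauss' relation between \<open>F(a, b; c)\<close>, \<open>F(a, b + 1; c + 1)\<close> and
  \<open>F(a + 1, b + 1; c + 2)\<close>, hence in each step of his continued fraction.
\<close>

definition gauss_coeff :: "real \<Rightarrow> real \<Rightarrow> real \<Rightarrow> real"
  where "gauss_coeff a b c = a * (c - b) / (c * (c + 1))"

lemma hyp_contiguous_gauss:
  assumes "c > 0"
  shows "hyp a (b + 1) (c + 1) =
         hyp a b c + fps_const (gauss_coeff a b c) * fps_X * hyp (a + 1) (b + 1) (c + 2)"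
proof (rule fps_ext)
  fix n
  show "fps_nth (hyp a (b + 1) (c + 1)) n =
        fps_nth (hyp a b c + fps_const (gauss_coeff a b c) * fps_X * hyp (a + 1) (b + 1) (c + 2)) n"
  proof (cases n)
    case (Suc m)
    define P Q R where "P = pochhammer (a + 1) m" and "Q = pochhammer (b + 1) m"
      and "R = pochhammer (c + 2) m"
    have "R > 0" using assms by (simp add: R_def pochhammer_pos)
    have eq: "pochhammer (b + 1) (Suc m) = (b + 1 + real m) * Q"
      unfolding Q_def by (rule pochhammer_rec')
    have eqs: "pochhammer a (Suc m) = a * P"
      "pochhammer b (Suc m) = b * Q" "pochhammer (c + 1) (Suc m) = (c + 1) * R"
      using pochhammer_rec[of "c + 1" m]
      by (simp_all add: P_def Q_def R_def pochhammer_rec add.assoc)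
    have "(c + 1 + real m) * pochhammer c (Suc m) = pochhammer c (Suc (Suc m))"
      by (simp add: pochhammer_rec' add_ac)
    also have "\<dots> = c * ((c + 1) * R)"
      using eqs(3) by (simp only: pochhammer_rec[of c "Suc m"])
    finally have "pochhammer c (Suc m) = c * (c + 1) * R / (c + 1 + real m)"
      using assms by (simp add: field_simps)
    note eqs = this eq eqs(1,2) eqs(3)
    have nz: "c + 1 + real m > 0" "c + 1 > 0" using assms by auto
    show ?thesis
      using nz assms Suc \<open>R > 0\<close>
      by (simp add: eqs mult.assoc fps_mult_left_const_nth P_def [symmetric] Q_def [symmetric]
            R_def [symmetric] gauss_coeff_def fact_Suc_real divide_simps del: fact_Suc of_nat_Suc) (simp add: algebra_simps)
  qed simp
qed

section \<open>Gauss' continued fraction\<close>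

definition gauss_quotient :: "real \<Rightarrow> real \<Rightarrow> real \<Rightarrow> real fps"
  where "gauss_quotient a b c = hyp a (b + 1) (c + 1) / hyp a b c"

lemma gauss_quotient_mult: "gauss_quotient a b c * hyp a b c = hyp a (b + 1) (c + 1)"
  by (simp add: gauss_quotient_def fps_divide_unit mult.assoc inverse_mult_eq_1)

lemma gauss_quotient_0 [simp]: "fps_nth (gauss_quotient a b c) 0 = 1"
  using arg_cong[OF gauss_quotient_mult[of a b c], of "\<lambda>P. fps_nth P 0"]
  by (simp add: fps_mult_nth del: fps_hypergeo_nth)

text \<open>
  Dividing the contiguous relation by \<open>F(a, b; c)\<close> gives \<open>G = 1 + k z G' G\<close>, that is
  \<open>G = 1 / (1 - k z G')\<close>, where \<open>G'\<close> is again a quotient of the same kind: by symmetry in the two upper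
  parameters, \<open>F(a + 1, b + 1; c + 2) / F(a, b + 1; c + 1)\<close> is the quotient for \<open>(b + 1, a, c + 1)\<close>.
\<close>

lemma gauss_quotient_rec:
  assumes "c > 0"
  shows "gauss_quotient a b c = 1 + fps_const (gauss_coeff a b c) * fps_X *
           (gauss_quotient (b + 1) a (c + 1) * gauss_quotient a b c)"
proof -
  let ?F = "hyp a b c"
  have nz: "?F \<noteq> 0"
    using fps_hypergeo_0[of "[a, b]" "[c]" 1] by (auto simp del: fps_hypergeo_nth fps_hypergeo_0)
  have shift: "hyp (a + 1) (b + 1) (c + 2) =
      gauss_quotient (b + 1) a (c + 1) * (gauss_quotient a b c * ?F)"
    using gauss_quotient_mult[of "b + 1" a "c + 1"]
    by (simp add: gauss_quotient_mult[of a b c] hyp_commute[of "b + 1"] add.assoc)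
  have "gauss_quotient a b c * ?F =
      ?F + fps_const (gauss_coeff a b c) * fps_X * hyp (a + 1) (b + 1) (c + 2)"
    by (simp only: gauss_quotient_mult hyp_contiguous_gauss[OF assms, of a b])
  also note shift
  finally have "gauss_quotient a b c * ?F = (1 + fps_const (gauss_coeff a b c) * fps_X *
           (gauss_quotient (b + 1) a (c + 1) * gauss_quotient a b c)) * ?F"
    by (simp only: algebra_simps mult_1_left)
  then show ?thesis by (rule iffD1[OF mult_right_cancel[OF nz]])
qed

text \<open>
  These conditions on the parameters make the coefficient positive and are inherited by the next step
  of the continued fraction.
\<close>

definition gauss_admissible :: "real \<Rightarrow> real \<Rightarrow> real \<Rightarrow> bool"
  where "gauss_admissible a b c \<longleftrightarrow> 0 < a \<and> a < c + 1 \<and> 0 < b \<and> b < c"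

lemma gauss_admissible_step: "gauss_admissible a b c \<Longrightarrow> gauss_admissible (b + 1) a (c + 1)"
  by (simp add: gauss_admissible_def)

lemma gauss_coeff_pos: "gauss_admissible a b c \<Longrightarrow> gauss_coeff a b c > 0"
  by (simp add: gauss_admissible_def gauss_coeff_def)

lemma nth_Suc_X_mult:
  "fps_nth (1 + fps_const k * fps_X * (P * Q)) (Suc n) =
     (k :: real) * (\<Sum>i\<le>n. fps_nth P i * fps_nth Q (n - i))"
  by (simp add: mult.assoc fps_mult_left_const_nth fps_mult_nth[of P Q] atLeast0AtMost)

text \<open>
  In \<open>G = 1 + k z G' G\<close> each coefficient after the first is a positive combination of products of earlier coefficients of \<open>G\<close> and
  of \<open>G'\<close>; so the induction runs over the index, for all admissible parameters at once.
\<close>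

lemma gauss_quotient_nonneg:
  assumes "gauss_admissible a b c"
  shows "fps_nth (gauss_quotient a b c) n \<ge> 0"
  using assms
proof (induction n arbitrary: a b c rule: less_induct)
  case (less n)
  show ?case
  proof (cases n)
    case (Suc m)
    have "c > 0" using less.prems by (auto simp: gauss_admissible_def)
    have "fps_nth (gauss_quotient a b c) (Suc m) = gauss_coeff a b c *
        (\<Sum>i\<le>m. fps_nth (gauss_quotient (b + 1) a (c + 1)) i * fps_nth (gauss_quotient a b c) (m - i))"
      by (subst gauss_quotient_rec[OF \<open>c > 0\<close>]) (rule nth_Suc_X_mult)
    also have "\<dots> \<ge> 0"
      using less.IH[OF _ gauss_admissible_step[OF less.prems]] less.IH[OF _ less.prems]
        gauss_coeff_pos[OF less.prems] Suc
      by (intro mult_nonneg_nonneg sum_nonneg) auto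
    finally show ?thesis using Suc by simp
  qed simp
qed

lemma disc_conv_gauss_quotient:
  assumes "gauss_admissible a b c"
  shows "disc_conv (gauss_quotient a b c)"
proof -
  have pos: "a > 0" "b > 0" "c > 0" using assms by (auto simp: gauss_admissible_def)
  have "fps_nth (gauss_quotient a b c) n \<le> fps_nth (hyp a (b + 1) (c + 1)) n" for n
  proof -
    have "fps_nth (gauss_quotient a b c) n * fps_nth (hyp a b c) (n - n) \<le>
        (\<Sum>i\<le>n. fps_nth (gauss_quotient a b c) i * fps_nth (hyp a b c) (n - i))"
      using hyp_pos[OF pos] gauss_quotient_nonneg[OF assms]
      by (intro member_le_sum) (auto intro!: mult_nonneg_nonneg simp: less_imp_le simp del: fps_hypergeo_nth)
    then show ?thesis
      by (simp add: gauss_quotient_mult[symmetric] fps_mult_nth atLeast0AtMost del: fps_hypergeo_nth)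
  qed
  then show ?thesis
    by (rule disc_conv_mono[OF gauss_quotient_nonneg[OF assms]]) (use pos in \<open>simp add: disc_conv_hyp\<close>)
qed

primrec gauss_convergent :: "nat \<Rightarrow> real \<Rightarrow> real \<Rightarrow> real \<Rightarrow> real fps" where
  "gauss_convergent 0 a b c = 1"
| "gauss_convergent (Suc N) a b c =
     inverse (1 - fps_const (gauss_coeff a b c) * fps_X * gauss_convergent N (b + 1) a (c + 1))"

lemma gauss_convergent_inverse:
  "gauss_convergent (Suc N) a b c *
     (1 - fps_const (gauss_coeff a b c) * fps_X * gauss_convergent N (b + 1) a (c + 1)) = 1"
  by (simp add: inverse_mult_eq_1 mult.assoc)

lemma gauss_convergent_rec:
  "gauss_convergent (Suc N) a b c = 1 + fps_const (gauss_coeff a b c) * fps_X *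
     (gauss_convergent N (b + 1) a (c + 1) * gauss_convergent (Suc N) a b c)"
  using gauss_convergent_inverse[of N a b c]
  by (simp add: algebra_simps del: gauss_convergent.simps)

lemma gauss_convergent_0 [simp]: "fps_nth (gauss_convergent N a b c) 0 = 1"
  by (cases N) auto

text \<open>
  The truncated fractions obey the recursion of the full one, so by the same induction their
  coefficients lie between 0 and those of the quotient, and those of low order already agree. The quotient
  thus dominates all convergents, which is what the passage to the limit needs.
\<close>

lemma gauss_convergent_bounds:
  assumes "gauss_admissible a b c"
  shows "0 \<le> fps_nth (gauss_convergent N a b c) n \<and>
         fps_nth (gauss_convergent N a b c) n \<le> fps_nth (gauss_quotient a b c) n \<and>
         (n \<le> N \<longrightarrow> fps_nth (gauss_convergent N a b c) n = fps_nth (gauss_quotient a b c) n)"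
  using assms
proof (induction N arbitrary: a b c n)
  case 0
  then show ?case using gauss_quotient_nonneg[of a b c n] by (cases n) auto
next
  case (Suc N)
  let ?T' = "gauss_convergent N (b + 1) a (c + 1)" and ?G' = "gauss_quotient (b + 1) a (c + 1)"
  let ?T = "gauss_convergent (Suc N) a b c" and ?G = "gauss_quotient a b c"
  note IH' = Suc.IH[OF gauss_admissible_step[OF Suc.prems]]
  have "c > 0" using Suc.prems by (auto simp: gauss_admissible_def)
  note k = gauss_coeff_pos[OF Suc.prems]
  show ?case
  proof (induction n rule: less_induct)
    case (less n)
    show ?case
    proof (cases n)
      case (Suc m)
      have T: "fps_nth ?T (Suc m) = gauss_coeff a b c * (\<Sum>i\<le>m. fps_nth ?T' i * fps_nth ?T (m - i))"
        by (subst gauss_convergent_rec) (rule nth_Suc_X_mult)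
      have G: "fps_nth ?G (Suc m) = gauss_coeff a b c * (\<Sum>i\<le>m. fps_nth ?G' i * fps_nth ?G (m - i))"
        by (subst gauss_quotient_rec[OF \<open>c > 0\<close>]) (rule nth_Suc_X_mult)
      have "0 \<le> fps_nth ?T (Suc m)"
        unfolding T using k IH' less.IH Suc
        by (intro mult_nonneg_nonneg sum_nonneg) (auto simp del: gauss_convergent.simps)
      moreover have "fps_nth ?T (Suc m) \<le> fps_nth ?G (Suc m)"
        unfolding T G using k IH' less.IH Suc
        by (intro mult_left_mono sum_mono mult_mono)
           (auto simp del: gauss_convergent.simps intro: order_trans)
      moreover have "fps_nth ?T (Suc m) = fps_nth ?G (Suc m)" if "Suc m \<le> Suc N"
      proof -
        have "(\<Sum>i\<le>m. fps_nth ?T' i * fps_nth ?T (m - i)) = (\<Sum>i\<le>m. fps_nth ?G' i * fps_nth ?G (m - i))"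
          using IH' less.IH Suc that
          by (intro sum.cong refl arg_cong2[of _ _ _ _ "(*)"]) (auto simp del: gauss_convergent.simps)
        then show ?thesis unfolding T G by simp
      qed
      ultimately show ?thesis using Suc by blast
    qed simp
  qed
qed

lemma disc_conv_gauss_convergent:
  assumes "gauss_admissible a b c"
  shows "disc_conv (gauss_convergent N a b c)"
  using gauss_convergent_bounds[OF assms]
  by (intro disc_conv_mono[OF _ _ disc_conv_gauss_quotient[OF assms]]) auto

lemma gauss_convergent_tendsto:
  assumes adm: "gauss_admissible a b c" and z: "norm z < 1"
  shows "(\<lambda>N. eval_fps (cfps (gauss_convergent N a b c)) z)
           \<longlonglongrightarrow> eval_fps (cfps (gauss_quotient a b c)) z"
proof -
  let ?G = "gauss_quotient a b c"
  have rad: "ereal (norm z) < fps_conv_radius ?G"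
    by (rule disc_conv_less[OF disc_conv_gauss_quotient[OF adm] z])
  have "summable (\<lambda>n. norm (fps_nth ?G n * norm z ^ n))"
    using rad by (intro norm_summable_fps) simp
  then have M: "summable (\<lambda>n. fps_nth ?G n * norm z ^ n)"
    by (rule summable_norm_cancel)
  have "(\<lambda>N. \<Sum>n. fps_nth (cfps (gauss_convergent N a b c)) n * z ^ n) \<longlonglongrightarrow>
      (\<Sum>n. fps_nth (cfps ?G) n * z ^ n)"
  proof (rule conjunct2[OF conjunct2[OF tannerys_theorem[OF _ _ M]]])
    fix n
    have "\<forall>\<^sub>F N in sequentially. fps_nth (cfps (gauss_convergent N a b c)) n * z ^ n = fps_nth (cfps ?G) n * z ^ n"
      using gauss_convergent_bounds[OF adm] by (intro eventually_sequentiallyI[of n]) auto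
    then show "(\<lambda>N. fps_nth (cfps (gauss_convergent N a b c)) n * z ^ n) \<longlonglongrightarrow> fps_nth (cfps ?G) n * z ^ n"
      by (rule tendsto_eventually)
  next
    have "norm (fps_nth (cfps (gauss_convergent N a b c)) n * z ^ n) \<le> fps_nth ?G n * norm z ^ n" for n N
      using gauss_convergent_bounds[OF adm, of N n]
      by (auto simp: norm_mult norm_power intro!: mult_right_mono)
    then show "\<forall>\<^sub>F (n, N) in sequentially \<times>\<^sub>F sequentially.
        norm (fps_nth (cfps (gauss_convergent N a b c)) n * z ^ n) \<le> fps_nth ?G n * norm z ^ n"
      by (intro always_eventually) auto
  qed simp
  then show ?thesis by (simp add: eval_fps_def)
qed

text \<open>
  One step \<open>t' \<mapsto> t = 1 / (1 - k z t')\<close> with \<open>k \<ge> 0\<close> and \<open>Im z > 0\<close> preserves the two conditions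
  \<open>Im t \<ge> 0\<close> and \<open>Im (z t) \<ge> 0\<close> taken together: the conjugate of the denominator has imaginary part
  \<open>k Im (z t')\<close>, and \<open>z\<close> times it has imaginary part \<open>Im z + k \<bar>z\<bar>\<^sup>2 Im t'\<close>.
\<close>

lemma Im_divide_one_minus:
  fixes z t :: complex
  assumes "Im z > 0" "k \<ge> 0" "t * (1 - of_real k * z * t') = 1" "Im t' \<ge> 0" "Im (z * t') \<ge> 0"
  shows "Im t \<ge> 0" "Im (z * t) \<ge> 0"
proof -
  let ?d = "1 - of_real k * z * t'"
  have "?d \<noteq> 0" using assms(3) by auto
  then have "t = 1 / ?d"
    using assms(3) by (subst nonzero_eq_divide_eq) auto
  then have t: "t = cnj ?d / of_real ((norm ?d)\<^sup>2)"
    by (simp only: complex_div_cnj[of 1] mult_1_left of_real_power)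
  have "Im (cnj ?d) = k * Im (z * t')" by (simp add: algebra_simps)
  then show "Im t \<ge> 0" using assms t
    by (simp add: Im_divide_of_real)
  have "z * cnj ?d = z - of_real k * of_real ((norm z)\<^sup>2) * cnj t'"
    using complex_norm_square[of z] by (simp add: algebra_simps)
  then have "Im (z * cnj ?d) = Im z + k * (norm z)\<^sup>2 * Im t'"
    by simp
  then show "Im (z * t) \<ge> 0" using assms t
    by (simp add: Im_divide_of_real)
qed

lemma gauss_quotient_Pick:
  assumes adm: "gauss_admissible a b c" and z: "norm z < 1" "Im z > 0"
  defines "G \<equiv> eval_fps (cfps (gauss_quotient a b c)) z"
  shows "Im G \<ge> 0" "Im (z * G) \<ge> 0"
proof -
  have conv: "Im (eval_fps (cfps (gauss_convergent N a b c)) z) \<ge> 0 \<and>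
      Im (z * eval_fps (cfps (gauss_convergent N a b c)) z) \<ge> 0" for N
    using adm
  proof (induction N arbitrary: a b c)
    case 0
    then show ?case using z by simp
  next
    case (Suc N)
    note adm' = gauss_admissible_step[OF Suc.prems]
    let ?T = "gauss_convergent (Suc N) a b c" and ?T' = "gauss_convergent N (b + 1) a (c + 1)"
    have "eval_fps (cfps (?T * (1 - fps_const (gauss_coeff a b c) * fps_X * ?T'))) z = eval_fps (cfps 1) z"
      by (simp only: gauss_convergent_inverse)
    then have "eval_fps (cfps ?T) z * (1 - of_real (gauss_coeff a b c) * z * eval_fps (cfps ?T') z) = 1"
      using disc_conv_gauss_convergent[OF Suc.prems] disc_conv_gauss_convergent[OF adm']
      by (simp only: eval_cfps[OF z(1)] disc_conv_intros)
    from Im_divide_one_minus[OF z(2) less_imp_le[OF gauss_coeff_pos[OF Suc.prems]] this]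
      Suc.IH[OF adm']
    show ?case by blast
  qed
  note lim = gauss_convergent_tendsto[OF adm z(1)]
  show "Im G \<ge> 0"
    unfolding G_def
    by (rule tendsto_lowerbound[OF tendsto_Im[OF lim]]) (use conv in auto)
  show "Im (z * G) \<ge> 0"
    unfolding G_def
    by (rule tendsto_lowerbound[OF tendsto_Im[OF tendsto_mult_left[OF lim]]]) (use conv in auto)
qed

section \<open>The quotient of F' by (z F)'\<close>

definition shifted_deriv :: "real \<Rightarrow> real \<Rightarrow> real \<Rightarrow> real fps"
  where "shifted_deriv a b c = hyp a b c + fps_X * fps_deriv (hyp a b c)"

definition deriv_quotient :: "real \<Rightarrow> real \<Rightarrow> real \<Rightarrow> real fps"
  where "deriv_quotient a b c = fps_deriv (hyp a b c) / shifted_deriv a b c"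

lemma shifted_deriv_nth: "fps_nth (shifted_deriv a b c) n = (1 + real n) * fps_nth (hyp a b c) n"
  by (cases n) (simp_all add: shifted_deriv_def algebra_simps del: fps_hypergeo_nth)

lemma shifted_deriv_0 [simp]: "fps_nth (shifted_deriv a b c) 0 = 1"
  by (simp add: shifted_deriv_def)

lemma disc_conv_shifted_deriv: "a > 0 \<Longrightarrow> b > 0 \<Longrightarrow> c > 0 \<Longrightarrow> disc_conv (shifted_deriv a b c)"
  unfolding shifted_deriv_def by (intro disc_conv_intros disc_conv_hyp)

text \<open>
  The hypergeometric differential equation, solved for the second derivative of \<open>z F\<close>. Splitting off the
  term with \<open>(1 - a) (1 - b)\<close> isolates \<open>\<delta> = c - 1 - a - b + a b\<close> as the coefficient of \<open>F'\<close> that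
  survives at \<open>z = 1\<close>.
\<close>

lemma hyp_ode:
  fixes a b c :: real
  assumes "c > 0"
  defines "F \<equiv> hyp a b c"
  defines "f' \<equiv> F + fps_X * fps_deriv F"
  shows "(1 - fps_X) * fps_deriv f' =
           fps_const ((1 - a) * (1 - b)) * (1 - fps_X) * fps_deriv F
         + fps_const (a * b) * f' - fps_const (c - 1 - a - b + a * b) * fps_deriv F"
proof (rule fps_ext)
  fix n
  have rec: "(c + real n) * (1 + real n) * fps_nth F (Suc n) = (a + real n) * (b + real n) * fps_nth F n" for n
    unfolding F_def by (rule hyp_Suc[OF assms(1)])
  show "fps_nth ((1 - fps_X) * fps_deriv f') n =
        fps_nth (fps_const ((1 - a) * (1 - b)) * (1 - fps_X) * fps_deriv F
         + fps_const (a * b) * f' - fps_const (c - 1 - a - b + a * b) * fps_deriv F) n"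
  proof (cases n)
    case 0
    have "c * fps_nth F 1 = a * b * fps_nth F 0" using rec[of 0] by simp
    then show ?thesis using 0 by (simp add: f'_def algebra_simps fps_mult_left_const_nth)
  next
    case (Suc m)
    have D: "fps_deriv f' = fps_const 2 * fps_deriv F + fps_X * fps_deriv (fps_deriv F)"
      by (simp add: f'_def numeral_fps_const)
    have *: "(1 - fps_X) * G = G - fps_X * G" for G :: "real fps" by (simp add: algebra_simps)
    show ?thesis using Suc rec[of "Suc m"]
      by (cases m) (simp_all add: D, simp_all add: f'_def * mult.assoc fps_mult_left_const_nth algebra_simps)
  qed
qed

lemma deriv_quotient_mult:
  "deriv_quotient a b c * shifted_deriv a b c = fps_deriv (hyp a b c)"
  by (simp add: deriv_quotient_def fps_divide_unit mult.assoc inverse_mult_eq_1)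

text \<open>
  With \<open>\<Phi> = F(a + 1, b; c)\<close> and \<open>H\<close> the Gauss quotient for \<open>(a + 1, b, c)\<close>, the contiguous relations read
  \<open>F' = (a b / c) H \<Phi>\<close> and \<open>(z F)' = (1 - (1 - a) (b / c) z H) \<Phi>\<close>. So \<open>q\<close> is one more step of the
  continued fraction; for positive \<open>b\<close> and \<open>c\<close> its coefficient is nonnegative exactly when \<open>a \<le> 1\<close>.
\<close>

lemma deriv_quotient_gauss:
  assumes "c > 0"
  shows "deriv_quotient a b c * (1 - fps_const ((1 - a) * b / c) * (fps_X * gauss_quotient (a + 1) b c)) =
         fps_const (a * b / c) * gauss_quotient (a + 1) b c"
proof -
  let ?\<Phi> = "hyp (a + 1) b c" and ?H = "gauss_quotient (a + 1) b c" and ?q = "deriv_quotient a b c"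
  let ?m = "(1 - a) * b / c"
  have nz: "?\<Phi> \<noteq> 0"
    using fps_hypergeo_0[of "[a + 1, b]" "[c]" 1] by (auto simp del: fps_hypergeo_nth fps_hypergeo_0)
  have \<Psi>: "hyp (a + 1) (b + 1) (c + 1) = ?H * ?\<Phi>"
    by (simp only: gauss_quotient_mult)
  have D: "fps_deriv (hyp a b c) = fps_const (a * b / c) * (?H * ?\<Phi>)"
    by (simp only: fps_deriv_hyp \<Psi>)
  have F: "hyp a b c = ?\<Phi> - fps_const (b / c) * fps_X * (?H * ?\<Phi>)"
    using hyp_contiguous_upper[OF assms, of a b] unfolding \<Psi> by (simp add: algebra_simps)
  have m: "fps_const (b / c) - fps_const (a * b / c) = fps_const ?m"
    by (simp add: algebra_simps diff_divide_distrib)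
  have "shifted_deriv a b c = ?\<Phi> - fps_const (b / c) * fps_X * (?H * ?\<Phi>) +
      fps_X * (fps_const (a * b / c) * (?H * ?\<Phi>))"
    by (simp only: shifted_deriv_def D) (simp only: F)
  also have "\<dots> = ?\<Phi> - (fps_const (b / c) - fps_const (a * b / c)) * (fps_X * (?H * ?\<Phi>))"
    by (simp only: algebra_simps)
  also have "\<dots> = (1 - fps_const ?m * (fps_X * ?H)) * ?\<Phi>"
    unfolding m by (simp only: algebra_simps mult_1_left)
  finally have "?q * (1 - fps_const ?m * (fps_X * ?H)) * ?\<Phi> = ?q * shifted_deriv a b c"
    by (simp only: mult.assoc)
  also have "\<dots> = fps_const (a * b / c) * ?H * ?\<Phi>"
    by (simp only: deriv_quotient_mult D mult.assoc)
  finally show ?thesis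
    by (rule iffD1[OF mult_right_cancel[OF nz]])
qed

context
  fixes a b c :: real
  assumes a: "0 < a" "a \<le> 1" "a < c" and b: "0 < b" "b < c"
begin

lemma deriv_quotient_admissible: "gauss_admissible (a + 1) b c" and third_parameter_pos: "c > 0"
  using a b by (simp_all add: gauss_admissible_def)

lemma deriv_quotient_nonneg: "fps_nth (deriv_quotient a b c) n \<ge> 0"
proof (induction n rule: less_induct)
  case (less n)
  let ?H = "gauss_quotient (a + 1) b c" and ?q = "deriv_quotient a b c"
  have "?q = fps_const (a * b / c) * ?H + fps_const ((1 - a) * b / c) * (fps_X * (?H * ?q))"
    using deriv_quotient_gauss[OF third_parameter_pos, of a b] by (simp add: algebra_simps)
  then have eq: "fps_nth ?q n = a * b / c * fps_nth ?H n +
      (1 - a) * b / c * fps_nth (fps_X * (?H * ?q)) n"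
    by (metis fps_add_nth fps_mult_left_const_nth)
  have "fps_nth (fps_X * (?H * ?q)) n \<ge> 0"
  proof (cases n)
    case (Suc m)
    then show ?thesis
      using less gauss_quotient_nonneg[OF deriv_quotient_admissible]
      by (auto simp: fps_mult_nth[of ?H] intro!: sum_nonneg mult_nonneg_nonneg)
  qed simp
  then show ?case
    unfolding eq using a b third_parameter_pos gauss_quotient_nonneg[OF deriv_quotient_admissible]
    by (intro add_nonneg_nonneg mult_nonneg_nonneg) auto
qed

lemma disc_conv_deriv_quotient: "disc_conv (deriv_quotient a b c)"
proof -
  let ?q = "deriv_quotient a b c"
  note pos = less_imp_le[OF hyp_pos[OF a(1) b(1) third_parameter_pos]]
  have "fps_nth ?q n \<le> fps_nth (fps_deriv (hyp a b c)) n" for n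
  proof -
    have "fps_nth ?q n * fps_nth (shifted_deriv a b c) (n - n) \<le>
        (\<Sum>i\<le>n. fps_nth ?q i * fps_nth (shifted_deriv a b c) (n - i))"
      using pos deriv_quotient_nonneg
      by (intro member_le_sum) (auto intro!: mult_nonneg_nonneg simp: shifted_deriv_nth simp del: fps_hypergeo_nth)
    also have "\<dots> = fps_nth (fps_deriv (hyp a b c)) n"
      unfolding deriv_quotient_mult[symmetric] by (simp add: fps_mult_nth atLeast0AtMost)
    finally show ?thesis by simp
  qed
  then show ?thesis
    by (rule disc_conv_mono[OF deriv_quotient_nonneg])
       (intro disc_conv_intros disc_conv_hyp a(1) b(1) third_parameter_pos)
qed

lemma deriv_quotient_Pick:
  assumes z: "norm z < 1" "Im z > 0"
  shows "Im (eval_fps (cfps (deriv_quotient a b c)) z) \<ge> 0"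
proof -
  define m where "m = (1 - a) * b / c"
  define q where "q = eval_fps (cfps (deriv_quotient a b c)) z"
  define H where "H = eval_fps (cfps (gauss_quotient (a + 1) b c)) z"
  have m: "m \<ge> 0" using a b third_parameter_pos by (simp add: m_def)
  have "eval_fps (cfps (deriv_quotient a b c * (1 - fps_const m * (fps_X * gauss_quotient (a + 1) b c)))) z =
      eval_fps (cfps (fps_const (a * b / c) * gauss_quotient (a + 1) b c)) z"
    unfolding m_def by (simp only: deriv_quotient_gauss[OF third_parameter_pos])
  then have eq: "q * (1 - of_real m * (z * H)) = of_real (a * b / c) * H"
    unfolding q_def H_def using disc_conv_gauss_quotient[OF deriv_quotient_admissible] disc_conv_deriv_quotient
    by (simp only: eval_cfps[OF z(1)] disc_conv_intros)
  have H: "Im H \<ge> 0"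
    unfolding H_def by (rule gauss_quotient_Pick[OF deriv_quotient_admissible z])
  let ?d = "1 - of_real m * (z * H)"
  show ?thesis
  proof (cases "?d = 0")
    case True
    with eq a b third_parameter_pos have "H = 0" by auto
    with True show ?thesis by simp
  next
    case False
    with eq have "q = of_real (a * b / c) * H / ?d" by (intro eq_divide_imp)
    also have "\<dots> = of_real (a * b / c) * (H * cnj ?d) / of_real ((norm ?d)\<^sup>2)"
      by (subst complex_div_cnj) (simp add: mult_ac)
    also have "H * cnj ?d = H - of_real m * cnj z * of_real ((norm H)\<^sup>2)"
      using complex_norm_square[of H] by (simp add: algebra_simps)
    finally have "Im q = a * b / c * (Im H + m * Im z * (norm H)\<^sup>2) / (norm ?d)\<^sup>2"
      by (simp add: Im_divide_of_real)
    also have "\<dots> \<ge> 0"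
      using a b third_parameter_pos H m z by (intro divide_nonneg_nonneg mult_nonneg_nonneg add_nonneg_nonneg) auto
    finally show ?thesis by (simp add: q_def)
  qed
qed

end

section \<open>A half-plane estimate for Pick functions\<close>

text \<open>
  On the unit circle \<open>(1 + z) / (1 - z)\<close> is \<open>\<i> y\<close> with \<open>y\<close> of the sign of \<open>Im z\<close>, so there the real part
  in question is \<open>y Im Q \<ge> 0\<close>, and the minimum principle should carry this into the disc. Two obstacles
  are removed first: \<open>Q\<close> is replaced by \<open>h w = Q (r w)\<close> to be analytic across the circle, and the pole
  at 1 is cancelled by subtracting the real number \<open>h 1\<close>; what is subtracted contributes
  \<open>(M - h 1) Re ((1 + z) / (1 - z)) \<ge> 0\<close>.
\<close>

lemma Re_Cayley_Pick_nonneg: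
  fixes Q :: "complex \<Rightarrow> complex" and M :: real
  assumes hol: "Q holomorphic_on ball 0 1"
    and Pick: "\<And>z. norm z < 1 \<Longrightarrow> Im z * Im (Q z) \<ge> 0"
    and real: "\<And>x. 0 \<le> x \<Longrightarrow> x < 1 \<Longrightarrow> Im (Q (of_real x)) = 0"
    and bound: "\<And>x. 0 \<le> x \<Longrightarrow> x < 1 \<Longrightarrow> Re (Q (of_real x)) \<le> M"
    and z: "norm z < 1"
  shows "Re ((1 + z) / (1 - z) * (of_real M - Q z)) \<ge> 0"
proof -
  have Cayley: "(1 + w) / (1 - w) = of_real ((1 - (norm w)\<^sup>2) / (norm (1 - w))\<^sup>2)
      + \<i> * of_real (2 * Im w / (norm (1 - w))\<^sup>2)" for w :: complex
  proof -
    have "(1 + w) * cnj (1 - w) = of_real (1 - (norm w)\<^sup>2) + \<i> * of_real (2 * Im w)"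
      by (simp add: complex_eq_iff cmod_power2) (simp add: algebra_simps power2_eq_square)
    then show ?thesis
      by (subst complex_div_cnj) (simp add: add_divide_distrib)
  qed
  have dilate: "Re ((1 + z) / (1 - z) * (of_real M - Q (of_real r * z))) \<ge> 0" if r: "0 < r" "r < 1" for r
  proof -
    define h where "h w = Q (of_real r * w)" for w
    \<comment> \<open>the difference quotient of \<open>h\<close> at 1, with the singularity removed\<close>
    define K where "K w = (if w = 1 then deriv h 1 else (h w - h 1) / (w - 1))" for w
    define \<phi> where "\<phi> w = - ((1 + w) * K w)" for w
    have h_hol: "h holomorphic_on ball 0 (1 / r)"
      unfolding h_def using r
      by (intro holomorphic_on_compose_gen[OF _ hol, unfolded o_def] holomorphic_intros)
         (auto simp: norm_mult field_simps)
    have "K holomorphic_on ball 0 (1 / r)"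
      unfolding K_def by (rule pole_lemma_open[OF h_hol open_ball])
    then have \<phi>_hol: "\<phi> holomorphic_on ball 0 (1 / r)"
      unfolding \<phi>_def by (intro holomorphic_intros)
    have sub: "cball 0 1 \<subseteq> ball (0::complex) (1 / r)"
    proof
      fix w :: complex assume "w \<in> cball 0 1"
      then have "r * norm w \<le> r" using r by (simp add: mult_left_le)
      then have "r * norm w < 1" using r by linarith
      then show "w \<in> ball 0 (1 / r)" using r by (simp add: field_simps)
    qed
    have cont: "continuous_on (cball 0 1) \<phi>"
      by (rule continuous_on_subset[OF holomorphic_on_imp_continuous_on[OF \<phi>_hol] sub])
    have h1: "Im (h 1) = 0" "Re (h 1) \<le> M"
      using real[of r] bound[of r] r by (simp_all add: h_def)
    have K_eq: "(1 + w) * K w = (1 + w) / (1 - w) * (h 1 - h w)" if "w \<noteq> 1" for w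
    proof -
      have "w - 1 \<noteq> 0" "1 - w \<noteq> 0" using that by auto
      then show ?thesis using that unfolding K_def by (simp add: divide_simps) (simp add: algebra_simps)
    qed
    have circle: "Re (\<phi> w) \<le> 0" if w: "norm w = 1" "w \<noteq> 1" for w
    proof -
      have "norm (of_real r * w) < 1" using r w by (simp add: norm_mult)
      from Pick[OF this] have "r * (Im w * Im (h w)) \<ge> 0" by (simp add: h_def mult_ac)
      with r have "Im w * Im (h w) \<ge> 0" by (simp add: zero_le_mult_iff)
      then have "2 * Im w / (norm (1 - w))\<^sup>2 * Im (h w) \<ge> 0"
        by (simp add: mult_ac)
      then show ?thesis
        unfolding \<phi>_def K_eq[OF w(2)] Cayley using w h1 by simp
    qed
    \<comment> \<open>At 1 itself the inequality is inherited from nearby points of the circle.\<close>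
    have "Re (\<phi> 1) \<le> 0"
    proof (rule tendsto_upperbound)
      let ?c = "\<lambda>n. cis (1 / of_nat (Suc n))"
      have "?c \<longlonglongrightarrow> cis 0"
        by (intro tendsto_intros LIMSEQ_inverse_real_of_nat[unfolded inverse_eq_divide])
      then show "(\<lambda>n. Re (\<phi> (?c n))) \<longlonglongrightarrow> Re (\<phi> 1)"
        by (intro tendsto_Re continuous_on_tendsto_compose[OF cont]) auto
      have "?c n \<noteq> 1" for n
      proof
        assume "?c n = 1"
        then have "sin (1 / real (Suc n)) = 0" by (metis cis.sel(2) one_complex.sel(2))
        moreover have "sin (1 / real (Suc n)) > 0"
        proof (rule sin_gt_zero)
          have "1 / real (Suc n) \<le> 1" by simp
          then show "1 / real (Suc n) < pi" using pi_gt3 by linarith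
        qed simp
        ultimately show False by simp
      qed
      then show "\<forall>\<^sub>F n in sequentially. Re (\<phi> (?c n)) \<le> 0"
        by (intro always_eventually allI circle) auto
    qed simp
    then have circle': "Re (\<phi> w) \<le> 0" if "norm w = 1" for w
      using circle[OF that] by (cases "w = 1") simp_all
    have "Re (\<phi> z) \<le> 0"
    proof (rule maximum_real_frontier[of \<phi> "ball 0 1"])
      show "\<phi> holomorphic_on interior (ball 0 1)"
        using holomorphic_on_subset[OF \<phi>_hol order_trans[OF ball_subset_cball sub]] by simp
    qed (use z cont circle' in simp_all)
    moreover have "z \<noteq> 1" using z by auto
    ultimately have "Re ((1 + z) / (1 - z) * (h 1 - h z)) \<ge> 0"
      unfolding \<phi>_def using K_eq[of z] by simp
    moreover have "Re ((1 + z) / (1 - z) * (of_real M - h 1)) \<ge> 0"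
    proof -
      have "(norm z)\<^sup>2 \<le> 1" using z by (simp add: power_le_one)
      then show ?thesis unfolding Cayley using h1 by simp
    qed
    ultimately have "Re ((1 + z) / (1 - z) * (of_real M - h 1) + (1 + z) / (1 - z) * (h 1 - h z)) \<ge> 0"
      by simp
    also have "(1 + z) / (1 - z) * (of_real M - h 1) + (1 + z) / (1 - z) * (h 1 - h z) =
        (1 + z) / (1 - z) * (of_real M - h z)"
      by (simp only: distrib_left [symmetric]) simp
    finally show ?thesis by (simp add: h_def)
  qed
  have "isCont Q z"
    using holomorphic_on_imp_continuous_on[OF hol] z by (simp add: continuous_on_eq_continuous_at)
  moreover have "((\<lambda>r. of_real r * z) \<longlongrightarrow> of_real 1 * z) (at_left (1::real))"
    by (intro tendsto_intros)
  ultimately have "((\<lambda>r. Q (of_real r * z)) \<longlongrightarrow> Q z) (at_left (1::real))"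
    using isCont_tendsto_compose[of z Q] by simp
  then have "((\<lambda>r. Re ((1 + z) / (1 - z) * (of_real M - Q (of_real r * z)))) \<longlongrightarrow>
      Re ((1 + z) / (1 - z) * (of_real M - Q z))) (at_left (1::real))"
    by (intro tendsto_intros)
  then show ?thesis
  proof (rule tendsto_lowerbound)
    show "\<forall>\<^sub>F r in at_left (1::real). 0 \<le> Re ((1 + z) / (1 - z) * (of_real M - Q (of_real r * z)))"
      using eventually_at_left_real[OF zero_less_one] by (rule eventually_mono) (rule dilate, simp_all)
  qed simp
qed

section \<open>Positive curvature implies injectivity and convexity\<close>

lemma has_real_derivative_Re_of_real:
  assumes "(g has_field_derivative g') (at (complex_of_real t))"
  shows "((\<lambda>t. Re (g (complex_of_real t))) has_real_derivative Re g') (at t)"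
  by (intro has_field_derivative_Re has_vector_derivative_real_field assms)

lemma has_real_derivative_Im_of_real:
  assumes "(g has_field_derivative g') (at (complex_of_real t))"
  shows "((\<lambda>t. Im (g (complex_of_real t))) has_real_derivative Im g') (at t)"
  by (intro has_field_derivative_Im has_vector_derivative_real_field assms)

context
  fixes f :: "complex \<Rightarrow> complex"
  assumes hol: "f holomorphic_on ball 0 1"
    and regular: "\<And>z. norm z < 1 \<Longrightarrow> deriv f z \<noteq> 0"
    and pos: "\<And>z. norm z < 1 \<Longrightarrow> Re (1 + z * deriv (deriv f) z / deriv f z) > 0"
begin

text \<open>
  The tangent of the image of the circle at parameter \<open>t\<close> has the direction of \<open>\<i> exp (\<i> \<psi> t)\<close>, where
  \<open>\<psi> t = t + Im (log f')\<close>. The angle \<open>\<psi>\<close> is strictly increasing and gains exactly \<open>2 \<pi>\<close> over one period,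
  since \<open>log f'\<close> is single-valued. Let \<open>k\<close> be the signed distance of the curve from its tangent line at
  \<open>\<zeta>\<close>, up to a positive factor. It rises while \<open>\<psi>\<close> has turned by less than \<open>\<pi>\<close> and falls afterwards, back to its initial value 0;
  in between it is positive.
\<close>

lemma half_plane_support_circle:
  assumes r: "0 < r" "r < 1" and z\<zeta>: "norm \<zeta> = r" "norm z = r" "z \<noteq> \<zeta>"
  shows "Re ((f \<zeta> - f z) / (\<zeta> * deriv f \<zeta>)) > 0"
proof -
  have hol': "deriv f holomorphic_on ball 0 1"
    by (intro holomorphic_deriv hol) auto
  obtain L where L: "L holomorphic_on ball 0 1" "\<And>z. z \<in> ball 0 1 \<Longrightarrow> deriv f z = exp (L z)"
    by (rule contractible_imp_holomorphic_log[OF hol', of thesis])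
       (use regular in \<open>auto intro: convex_imp_contractible\<close>)
  have dL: "(L has_field_derivative deriv (deriv f) w / deriv f w) (at w)" if w: "norm w < 1" for w
  proof -
    have L': "(L has_field_derivative deriv L w) (at w)"
      using w by (intro holomorphic_derivI[OF L(1)]) auto
    then have "((\<lambda>w. exp (L w)) has_field_derivative exp (L w) * deriv L w) (at w)"
      by (rule derivative_intros)
    moreover have "(deriv f has_field_derivative deriv (deriv f) w) (at w)"
      using w by (intro holomorphic_derivI[OF hol']) auto
    then have "((\<lambda>w. exp (L w)) has_field_derivative deriv (deriv f) w) (at w)"
      by (rule has_field_derivative_transform_within_open[where S = "ball 0 1"]) (use w L(2) in auto)
    ultimately have "exp (L w) * deriv L w = deriv (deriv f) w" by (rule DERIV_unique)
    then have "deriv L w = deriv (deriv f) w / deriv f w"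
      using w L(2)[of w] by (simp add: field_simps)
    with L' show ?thesis by simp
  qed
  have df: "(f has_field_derivative deriv f w) (at w)" if w: "norm w < 1" for w
    using w by (intro holomorphic_derivI[OF hol]) auto
  define e where "e s = of_real r * exp (\<i> * s)" for s :: complex
  have e_norm: "norm (e (of_real t)) = r" for t using r by (simp add: e_def norm_mult)
  have de: "(e has_field_derivative \<i> * e s) (at s)" for s
    unfolding e_def by (auto intro!: derivative_eq_intros)
  define t0 where "t0 = Arg2pi (\<zeta> / of_real r)"
  have t0: "\<zeta> = e (of_real t0)"
    using z\<zeta>(1) complex_norm_eq_1_exp[of "\<zeta> / of_real r"] r
    by (simp add: e_def t0_def norm_divide)
  \<comment> \<open>\<open>z\<close> lies on the circle ahead of \<open>\<zeta>\<close> by the angle \<open>h\<close> in \<open>(0, 2 \<pi>)\<close>.\<close>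
  define h where "h = Arg2pi (z / \<zeta>)"
  have \<zeta>0: "\<zeta> \<noteq> 0" using z\<zeta> r by auto
  have "exp (\<i> * of_real h) = z / \<zeta>"
    unfolding h_def using z\<zeta> r by (subst complex_norm_eq_1_exp[symmetric]) (simp add: norm_divide)
  then have z_eq: "z = e (of_real (t0 + h))"
    using \<zeta>0 unfolding t0 by (simp add: e_def exp_add distrib_left)
  have h: "0 < h" "h < 2 * pi"
  proof -
    have "0 \<le> h" "h < 2 * pi" unfolding h_def using Arg2pi[of "z / \<zeta>"] by auto
    moreover have "h \<noteq> 0" using z_eq t0 z\<zeta>(3) by auto
    ultimately show "0 < h" "h < 2 * pi" by auto
  qed
  define \<psi> where "\<psi> t = t + Im (L (e (of_real t)))" for t :: real
  define k where "k t = Re ((f \<zeta> - f (e (of_real t))) / (\<zeta> * deriv f \<zeta>))" for t :: real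
  have d\<psi>: "(\<psi> has_real_derivative
      Re (1 + e (of_real t) * deriv (deriv f) (e (of_real t)) / deriv f (e (of_real t)))) (at t)" for t
  proof -
    let ?w = "e (of_real t)"
    have "norm ?w < 1" using r by (simp add: e_norm)
    from DERIV_chain2[OF dL[OF this] de]
    have "((\<lambda>s. L (e s)) has_field_derivative deriv (deriv f) ?w / deriv f ?w * (\<i> * ?w)) (at (of_real t))" .
    from DERIV_add[OF DERIV_ident has_real_derivative_Im_of_real[OF this]] show ?thesis
      unfolding \<psi>_def by (rule DERIV_cong) (simp add: Re_divide Im_divide, simp add: algebra_simps)
  qed
  have \<psi>_less: "\<psi> s < \<psi> t" if "s < t" for s t
  proof (rule DERIV_pos_imp_increasing[OF that])
    fix u
    have "norm (e (of_real u)) < 1" using r by (simp add: e_norm)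
    from pos[OF this] d\<psi>[of u] show "\<exists>y. (\<psi> has_real_derivative y) (at u) \<and> y > 0"
      by blast
  qed
  have period: "e (of_real (t + 2 * pi)) = e (of_real t)" for t
    unfolding e_def by (simp only: cis_conv_exp [symmetric]) (simp add: complex_eq_iff)
  have \<psi>_period: "\<psi> (t0 + 2 * pi) = \<psi> t0 + 2 * pi"
    unfolding \<psi>_def period by simp
  have dk: "(k has_real_derivative
      exp (Re (L (e (of_real t)) - L \<zeta>)) * sin (\<psi> t - \<psi> t0)) (at t)" for t
  proof -
    let ?w = "e (of_real t)"
    have w: "norm ?w < 1" using r by (simp add: e_norm)
    define A where "A = L ?w"
    define B where "B = L \<zeta>"
    have AB: "deriv f ?w = exp A" "deriv f \<zeta> = exp B"
      using w z\<zeta> r L(2) by (simp_all add: A_def B_def)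
    have rot: "Re (- (\<i> * x)) = Im x" for x by simp
    have "((\<lambda>s. (f \<zeta> - f (e s)) / (\<zeta> * deriv f \<zeta>)) has_field_derivative
        - (\<i> * (?w * deriv f ?w / (\<zeta> * deriv f \<zeta>)))) (at (of_real t))"
      by (rule DERIV_cong[OF DERIV_cdivide[OF DERIV_diff[OF DERIV_const DERIV_chain2[OF df[OF w] de]]]])
        (simp add: mult_ac)
    then have "(k has_real_derivative Re (- (\<i> * (?w * deriv f ?w / (\<zeta> * deriv f \<zeta>))))) (at t)"
      unfolding k_def by (rule has_real_derivative_Re_of_real)
    also have "Re (- (\<i> * (?w * deriv f ?w / (\<zeta> * deriv f \<zeta>)))) =
        Im (?w * deriv f ?w / (\<zeta> * deriv f \<zeta>))"
      by (rule rot)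
    also have "?w * deriv f ?w / (\<zeta> * deriv f \<zeta>) =
        of_real r * exp (\<i> * of_real t) * exp A / (of_real r * exp (\<i> * of_real t0) * exp B)"
      unfolding AB by (simp only: t0) (simp only: e_def)
    also have "\<dots> = exp (A - B + \<i> * (of_real t - of_real t0))"
      using r by (simp add: exp_add exp_diff right_diff_distrib mult_ac)
    also have "Im \<dots> = exp (Re (A - B)) * sin (Im (A - B) + (t - t0))"
      unfolding Im_exp by simp
    also have "Im (A - B) + (t - t0) = \<psi> t - \<psi> t0"
      unfolding \<psi>_def A_def B_def t0[symmetric] by simp
    finally show ?thesis by (simp only: A_def B_def)
  qed
  have k0: "k t0 = 0" "k (t0 + 2 * pi) = 0"
    unfolding k_def period by (simp_all add: t0)
  have cont_k: "continuous_on A k" for A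
    by (intro continuous_at_imp_continuous_on ballI DERIV_isCont[OF dk])
  have "k (t0 + h) > 0"
  proof (cases "\<psi> (t0 + h) - \<psi> t0 \<le> pi")
    case True
    have "k t0 < k (t0 + h)"
    proof (rule DERIV_pos_imp_increasing_open[where f = k])
      fix t assume t: "t0 < t" "t < t0 + h"
      have "sin (\<psi> t - \<psi> t0) > 0"
        using \<psi>_less[OF t(1)] \<psi>_less[OF t(2)] True by (intro sin_gt_zero) auto
      then have "exp (Re (L (e (of_real t)) - L \<zeta>)) * sin (\<psi> t - \<psi> t0) > 0"
        by (intro mult_pos_pos exp_gt_zero)
      with dk[of t] show "\<exists>y. (k has_real_derivative y) (at t) \<and> y > 0"
        by blast
    qed (use h cont_k in auto)
    then show ?thesis by (simp add: k0)
  next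
    case False
    have "k (t0 + h) > k (t0 + 2 * pi)"
    proof (rule DERIV_neg_imp_decreasing_open[where f = k])
      fix t assume t: "t0 + h < t" "t < t0 + 2 * pi"
      have "sin (\<psi> t - \<psi> t0) < 0"
        using \<psi>_less[OF t(1)] \<psi>_less[OF t(2)] False \<psi>_period by (intro sin_lt_zero) auto
      then have "exp (Re (L (e (of_real t)) - L \<zeta>)) * sin (\<psi> t - \<psi> t0) < 0"
        by (intro mult_pos_neg exp_gt_zero)
      with dk[of t] show "\<exists>y. (k has_real_derivative y) (at t) \<and> y < 0"
        by blast
    qed (use h cont_k in auto)
    then show ?thesis by (simp add: k0)
  qed
  then show ?thesis unfolding k_def z_eq .
qed

text \<open>
  The maximum principle extends the weak inequality to the inside of the circle, and openness of the
  image makes it strict: a point \<open>f z\<close> on the boundary of the half-plane could be moved to a value of \<open>f\<close>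
  outside of it.
\<close>

lemma half_plane_support_disc:
  assumes r: "0 < r" "r < 1" and z\<zeta>: "norm \<zeta> = r" "norm z \<le> r" "z \<noteq> \<zeta>"
  shows "Re ((f \<zeta> - f z) / (\<zeta> * deriv f \<zeta>)) > 0"
proof (cases "norm z = r")
  case True
  then show ?thesis using assms by (intro half_plane_support_circle[OF r]) auto
next
  case False
  then have z: "norm z < r" using z\<zeta> by auto
  let ?d = "\<zeta> * deriv f \<zeta>"
  have d0: "?d \<noteq> 0" using regular[of \<zeta>] z\<zeta> r by auto
  have sub: "cball 0 r \<subseteq> ball (0::complex) 1" "ball 0 r \<subseteq> ball (0::complex) 1"
    using r by auto
  have weak: "Re ((f \<zeta> - f w) / ?d) \<ge> 0" if w: "w \<in> ball 0 r" for w
  proof -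
    let ?g = "\<lambda>w. - ((f \<zeta> - f w) / ?d)"
    have hol_g: "?g holomorphic_on ball 0 1" using d0 by (intro holomorphic_intros hol) auto
    have "Re (?g w) \<le> 0"
    proof (rule maximum_real_frontier[of ?g "ball 0 r"])
      show "?g holomorphic_on interior (ball 0 r)"
        using holomorphic_on_subset[OF hol_g sub(2)] by simp
      show "continuous_on (closure (ball 0 r)) ?g"
        using holomorphic_on_imp_continuous_on[OF holomorphic_on_subset[OF hol_g sub(1)]] r by simp
      show "Re (?g u) \<le> 0" if "u \<in> frontier (ball 0 r)" for u
      proof (cases "u = \<zeta>")
        case False
        have "norm u = r" using that r by simp
        then show ?thesis using half_plane_support_circle[OF r z\<zeta>(1) _ False] by simp
      qed simp
    qed (use w in simp_all)
    then show ?thesis by simp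
  qed
  have "open (f ` ball 0 r)"
  proof (rule open_mapping_thm[OF hol open_ball connected_ball open_ball sub(2)])
    show "\<not> f constant_on ball 0 1"
    proof
      assume "f constant_on ball 0 1"
      then obtain y where y: "f w = y" if "w \<in> ball 0 1" for w by (auto simp: constant_on_def)
      have "(f has_field_derivative 0) (at 0)"
        by (rule has_field_derivative_transform_within_open[where f = "\<lambda>_. y" and S = "ball 0 1"])
           (simp_all add: y)
      then show False using regular[of 0] by (simp add: DERIV_imp_deriv)
    qed
  qed
  moreover have "f z \<in> f ` ball 0 r" using z by auto
  ultimately obtain \<epsilon> where \<epsilon>: "\<epsilon> > 0" "ball (f z) \<epsilon> \<subseteq> f ` ball 0 r"
    by (rule openE)
  define \<eta> where "\<eta> = \<epsilon> / (2 * norm ?d)"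
  have \<eta>: "\<eta> > 0" using \<epsilon> d0 by (simp add: \<eta>_def)
  have "norm (of_real \<eta> * ?d) = \<eta> * norm ?d"
    using \<eta> by (simp add: norm_mult)
  also have "\<dots> = \<epsilon> / 2"
    using d0 by (simp add: \<eta>_def)
  finally have "f z + of_real \<eta> * ?d \<in> ball (f z) \<epsilon>"
    using \<epsilon> by (simp add: dist_norm)
  with \<epsilon> obtain w where w: "w \<in> ball 0 r" "f w = f z + of_real \<eta> * ?d" by (auto dest!: subsetD)
  have "(f \<zeta> - f w) / ?d = (f \<zeta> - f z) / ?d - of_real \<eta>"
    using d0 w by (simp add: diff_divide_distrib add_divide_distrib)
  with weak[OF w(1)] \<eta> show ?thesis by simp
qed

text \<open>
  For \<open>\<bar>z\<bar> \<le> \<bar>\<zeta>\<bar>\<close> and \<open>z \<noteq> \<zeta>\<close> the value \<open>f z\<close> lies in an open half-plane that has \<open>f \<zeta>\<close> on its boundary,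
  so the two values differ.
\<close>

lemma injective_if_curvature_pos: "inj_on f (ball 0 1)"
proof -
  have *: "f z \<noteq> f \<zeta>" if "norm z \<le> norm \<zeta>" "norm \<zeta> < 1" "z \<noteq> \<zeta>" for z \<zeta>
    using half_plane_support_disc[of "norm \<zeta>" \<zeta> z] that by force
  show ?thesis
  proof (rule inj_onI)
    fix z w assume zw: "z \<in> ball 0 1" "w \<in> ball 0 1" "f z = f w"
    show "z = w"
      using *[of z w] *[of w z] zw by (cases "norm z \<le> norm w") auto
  qed
qed

text \<open>
  Let \<open>C\<close> be the intersection of the supporting half-planes at the points of the circle. It contains the
  image \<open>W\<close> of the open disc but no image of a point of the circle; so \<open>W = C \<inter> f (closed disc)\<close> is closed
  in \<open>C\<close>. It is also open, and \<open>C\<close> is convex, hence connected. Thus \<open>W = C\<close>.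
\<close>

lemma convex_image_disc:
  assumes r: "0 < r" "r < 1"
  shows "convex (f ` ball 0 r)"
proof -
  define H where "H \<zeta> = {w. Re ((f \<zeta> - w) / (\<zeta> * deriv f \<zeta>)) > 0}" for \<zeta>
  define C where "C = (\<Inter>\<zeta> \<in> sphere 0 r. H \<zeta>)"
  have sub: "cball 0 r \<subseteq> ball (0::complex) 1" "ball 0 r \<subseteq> ball (0::complex) 1" using r by auto
  have "convex (H \<zeta>)" for \<zeta>
  proof (rule convexI)
    fix x y :: complex and u v :: real
    assume xy: "x \<in> H \<zeta>" "y \<in> H \<zeta>" and uv: "0 \<le> u" "0 \<le> v" "u + v = 1"
    have "u * Re ((f \<zeta> - x) / (\<zeta> * deriv f \<zeta>)) + v * Re ((f \<zeta> - y) / (\<zeta> * deriv f \<zeta>)) > 0"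
    proof (cases "u = 0")
      case False
      then show ?thesis using xy uv by (intro add_pos_nonneg mult_pos_pos mult_nonneg_nonneg) (auto simp: H_def)
    qed (use xy uv in \<open>auto simp: H_def\<close>)
    moreover have "(f \<zeta> - (of_real u * x + of_real v * y)) / (\<zeta> * deriv f \<zeta>) =
        of_real u * ((f \<zeta> - x) / (\<zeta> * deriv f \<zeta>)) + of_real v * ((f \<zeta> - y) / (\<zeta> * deriv f \<zeta>))"
    proof -
      have v: "v = 1 - u" using uv by simp
      show ?thesis
        unfolding times_divide_eq_right add_divide_distrib [symmetric] v
        by (rule arg_cong2[of _ _ _ _ "(/)"]) (simp_all add: algebra_simps)
    qed
    ultimately show "u *\<^sub>R x + v *\<^sub>R y \<in> H \<zeta>"
      by (simp add: H_def scaleR_conv_of_real del: times_divide_eq_right)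
  qed
  then have "convex C" unfolding C_def by (intro convex_INT) auto
  have W_sub: "f ` ball 0 r \<subseteq> C"
  proof clarify
    fix z :: complex assume z: "z \<in> ball 0 r"
    show "f z \<in> C"
      unfolding C_def H_def
    proof (intro INT_I CollectI)
      fix \<zeta> :: complex assume "\<zeta> \<in> sphere 0 r"
      with z show "Re ((f \<zeta> - f z) / (\<zeta> * deriv f \<zeta>)) > 0"
        by (intro half_plane_support_disc[OF r]) auto
    qed
  qed
  have "open (f ` ball 0 r)"
    by (rule open_mapping_thm3) (use injective_if_curvature_pos hol sub in \<open>auto intro: holomorphic_on_subset inj_on_subset\<close>)
  then have "openin (top_of_set C) (f ` ball 0 r)"
    using W_sub by (simp add: open_subset)
  moreover have "closedin (top_of_set C) (f ` ball 0 r)"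
  proof -
    have "f ` ball 0 r = C \<inter> f ` cball 0 r"
    proof
      show "C \<inter> f ` cball 0 r \<subseteq> f ` ball 0 r"
      proof
        fix w assume "w \<in> C \<inter> f ` cball 0 r"
        then obtain z where z: "w = f z" "norm z \<le> r" "f z \<in> C" by auto
        have "norm z \<noteq> r"
        proof
          assume "norm z = r"
          with z(3) have "f z \<in> H z" by (auto simp: C_def)
          then show False by (simp add: H_def)
        qed
        with z show "w \<in> f ` ball 0 r" by auto
      qed
    qed (use W_sub in auto)
    moreover have "compact (f ` cball 0 r)"
      using hol sub by (intro compact_continuous_image) (auto intro: holomorphic_on_imp_continuous_on holomorphic_on_subset)
    ultimately show ?thesis
      by (simp add: closedin_closed_Int compact_imp_closed)
  qed
  moreover have "f ` ball 0 r \<noteq> {}" using r by auto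
  ultimately have "f ` ball 0 r = C"
    using connected_clopen[THEN iffD1, OF convex_connected[OF \<open>convex C\<close>], rule_format,
        of "f ` ball 0 r"] by blast
  with \<open>convex C\<close> show ?thesis by simp
qed

lemma convex_image_if_curvature_pos: "convex (f ` ball 0 1)"
  unfolding convex_contains_segment
proof (intro ballI)
  fix x y assume "x \<in> f ` ball 0 1" "y \<in> f ` ball 0 1"
  then obtain z w where zw: "x = f z" "y = f w" "norm z < 1" "norm w < 1" by auto
  define M where "M = max (norm z) (norm w)"
  have M: "0 \<le> M" "M < 1" "norm z \<le> M" "norm w \<le> M"
    using zw by (auto simp: M_def le_max_iff_disj)
  define r where "r = (1 + M) / 2"
  have r: "0 < r" "r < 1" "norm z < r" "norm w < r"
    using M by (simp_all add: r_def)
  have "closed_segment x y \<subseteq> f ` ball 0 r"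
    using convex_image_disc[OF r(1,2)] zw r by (auto simp: convex_contains_segment)
  also have "\<dots> \<subseteq> f ` ball 0 1" using r by (intro image_mono) auto
  finally show "closed_segment x y \<subseteq> f ` ball 0 1" .
qed

end

section \<open>Convexity of the shifted series\<close>

lemma shifted_hyp2f1_eq: "shifted_hyp2f1 a b c z = z * eval_fps (cfps (hyp a b c)) z"
proof -
  have "fps_hypergeo [of_real a, of_real b] [of_real c] 1 = cfps (hyp a b c)"
    by (simp add: fps_eq_iff pochhammer_of_real)
  then show ?thesis by (simp add: shifted_hyp2f1_def hyp2f1_def)
qed

lemma DERIV_shifted_hyp2f1:
  assumes "a > 0" "b > 0" "c > 0" "norm z < 1"
  shows "(shifted_hyp2f1 a b c has_field_derivative eval_fps (cfps (shifted_deriv a b c)) z) (at z)"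
proof -
  note conv = disc_conv_hyp[OF assms(1-3)]
  show ?thesis
    unfolding shifted_hyp2f1_eq[abs_def]
    by (rule DERIV_cong[OF DERIV_mult[OF DERIV_ident DERIV_eval_cfps[OF conv assms(4)]]])
       (simp only: shifted_deriv_def eval_cfps[OF assms(4)] conv disc_conv_intros mult_1_left mult.commute)
qed

lemma deriv_shifted_hyp2f1:
  assumes "a > 0" "b > 0" "c > 0" "norm z < 1"
  shows "deriv (shifted_hyp2f1 a b c) z = eval_fps (cfps (shifted_deriv a b c)) z"
    and "deriv (deriv (shifted_hyp2f1 a b c)) z = eval_fps (cfps (fps_deriv (shifted_deriv a b c))) z"
proof -
  have *: "deriv (shifted_hyp2f1 a b c) z = eval_fps (cfps (shifted_deriv a b c)) z" if "norm z < 1" for z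
    by (rule DERIV_imp_deriv[OF DERIV_shifted_hyp2f1[OF assms(1-3) that]])
  show "deriv (shifted_hyp2f1 a b c) z = eval_fps (cfps (shifted_deriv a b c)) z"
    by (rule *[OF assms(4)])
  have "(deriv (shifted_hyp2f1 a b c) has_field_derivative
      eval_fps (cfps (fps_deriv (shifted_deriv a b c))) z) (at z)"
    by (rule has_field_derivative_transform_within_open[where S = "ball 0 1",
          OF DERIV_eval_cfps[OF disc_conv_shifted_deriv]])
       (use assms * in auto)
  then show "deriv (deriv (shifted_hyp2f1 a b c)) z = eval_fps (cfps (fps_deriv (shifted_deriv a b c))) z"
    by (rule DERIV_imp_deriv)
qed

lemma shifted_deriv_ode_eval:
  assumes "a > 0" "b > 0" "c > 0" "norm z < 1"
  shows "(1 - z) * eval_fps (cfps (fps_deriv (shifted_deriv a b c))) z =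
           of_real ((1 - a) * (1 - b)) * (1 - z) * eval_fps (cfps (fps_deriv (hyp a b c))) z
         + of_real (a * b) * eval_fps (cfps (shifted_deriv a b c)) z
         - of_real (c - 1 - a - b + a * b) * eval_fps (cfps (fps_deriv (hyp a b c))) z"
proof -
  note conv = disc_conv_hyp[OF assms(1-3)] disc_conv_shifted_deriv[OF assms(1-3)]
  from hyp_ode[OF assms(3), of a b, folded shifted_deriv_def]
  have "eval_fps (cfps ((1 - fps_X) * fps_deriv (shifted_deriv a b c))) z =
      eval_fps (cfps (fps_const ((1 - a) * (1 - b)) * (1 - fps_X) * fps_deriv (hyp a b c)
         + fps_const (a * b) * shifted_deriv a b c
         - fps_const (c - 1 - a - b + a * b) * fps_deriv (hyp a b c))) z"
    by (rule arg_cong)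
  then show ?thesis
    using conv by (simp only: eval_cfps[OF assms(4)] disc_conv_intros)
qed

lemma shifted_deriv_eval:
  assumes "a > 0" "b > 0" "c > 0" "norm z < 1"
  shows "eval_fps (cfps (shifted_deriv a b c)) z =
           eval_fps (cfps (hyp a b c)) z + z * eval_fps (cfps (fps_deriv (hyp a b c))) z"
  unfolding shifted_deriv_def using disc_conv_hyp[OF assms(1-3)]
  by (simp only: eval_cfps[OF assms(4)] disc_conv_intros)

text \<open>
  \<open>g\<close> is a constant multiple of the exponential of a primitive of \<open>Q\<close>. This shows that the derivative of
  \<open>z F\<close> has no zeros in the disc, once its logarithmic derivative is known to be analytic there.
\<close>

lemma linear_ode_no_zero:
  assumes Q: "Q holomorphic_on ball 0 1"
    and g: "\<And>z. norm z < 1 \<Longrightarrow> (g has_field_derivative Q z * g z) (at z)"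
    and g0: "g 0 \<noteq> 0" and z: "norm z < 1"
  shows "g z \<noteq> (0::complex)"
proof -
  obtain E where E: "\<And>z. z \<in> ball 0 1 \<Longrightarrow> (E has_field_derivative Q z) (at z within ball 0 1)"
    by (rule holomorphic_convex_primitive'[OF convex_ball open_ball Q]) (rule that)
  have "((\<lambda>z. g z * exp (- E z)) has_field_derivative 0) (at w within ball 0 1)" if "w \<in> ball 0 1" for w
    using E[OF that] has_field_derivative_at_within[OF g[of w]] that
    by (auto intro!: derivative_eq_intros)
  from has_field_derivative_zero_constant[OF convex_ball this]
  obtain k where k: "\<And>w. w \<in> ball 0 1 \<Longrightarrow> g w * exp (- E w) = k" by auto
  from k[of 0] g0 have "k \<noteq> 0" by auto
  with k[of z] z show ?thesis by auto
qed

text \<open>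
  Here the differential equation, the two norm bounds for \<open>q\<close> and the half-plane estimate are put
  together. On \<open>[0, 1)\<close> the norm bounds are the inequalities \<open>F \<ge> 0\<close> and
  \<open>(1 - x) (f''(x) - (1 - a) (1 - b) F'(x)) \<ge> 0\<close>, divided by \<open>f'(x)\<close>.
\<close>

lemma convex_shifted_hyp2f1:
  fixes a b c :: real
  assumes a: "0 < a" "a < 1" and b: "0 < b" "b < 1" and c: "1 + a + b - a * b \<le> c"
  shows "convex_function (shifted_hyp2f1 a b c)"
proof -
  have "0 < a * (1 - b)" "0 < b * (1 - a)" using a b by auto
  then have ab: "a * b < a" "a * b < b" by (simp_all add: algebra_simps)
  have c1: "c > 1" using c ab a b by linarith
  have params: "a > 0" "b > 0" "c > 0" using a b c1 by auto
  define \<delta> where "\<delta> = c - 1 - a - b + a * b"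
  have \<delta>: "\<delta> \<ge> 0" using c by (simp add: \<delta>_def)
  define F F1 F2 S S1 q where "F = hyp a b c" and "F1 = fps_deriv F" and "F2 = fps_deriv F1"
    and "S = shifted_deriv a b c" and "S1 = fps_deriv S" and "q = deriv_quotient a b c"
  have dq: "0 < a" "a \<le> 1" "a < c" "0 < b" "b < c" using a b c1 by auto
  have q_conv: "disc_conv q"
    unfolding q_def by (rule disc_conv_deriv_quotient[OF dq])
  have conv: "disc_conv F" "disc_conv F1" "disc_conv F2" "disc_conv S" "disc_conv S1"
    unfolding F_def F1_def F2_def S_def S1_def
    by (intro disc_conv_intros disc_conv_hyp disc_conv_shifted_deriv params)+
  have F_pos: "fps_nth F n > 0" for n unfolding F_def by (rule hyp_pos[OF params])
  have nonneg: "fps_nth F n \<ge> 0" "fps_nth F1 n \<ge> 0" "fps_nth F2 n \<ge> 0" "fps_nth S n \<ge> 0" "fps_nth q n \<ge> 0" for n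
    using F_pos less_imp_le[OF F_pos] deriv_quotient_nonneg[OF dq]
    by (simp_all add: F1_def F2_def S_def q_def shifted_deriv_nth F_def del: fps_hypergeo_nth)
  let ?e = "\<lambda>P. eval_fps (cfps P)"
  have qS: "?e q z * ?e S z = ?e F1 z" if "norm z < 1" for z
  proof -
    have "?e (q * S) z = ?e F1 z"
      unfolding q_def S_def F1_def F_def deriv_quotient_mult ..
    then show ?thesis using q_conv conv by (simp only: eval_cfps[OF that])
  qed
  have SF: "?e S z = ?e F z + z * ?e F1 z" if "norm z < 1" for z
    unfolding S_def F_def F1_def by (rule shifted_deriv_eval[OF params that])
  have ode: "(1 - z) * ?e S1 z = of_real ((1 - a) * (1 - b)) * (1 - z) * ?e F1 z
      + of_real (a * b) * ?e S z - of_real \<delta> * ?e F1 z" if "norm z < 1" for z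
    unfolding S1_def S_def F_def F1_def \<delta>_def by (rule shifted_deriv_ode_eval[OF params that])
  have S1F: "?e S1 z = 2 * ?e F1 z + z * ?e F2 z" if "norm z < 1" for z
  proof -
    have "S1 = F1 + (F1 + fps_X * F2)"
      by (simp add: S1_def S_def shifted_deriv_def F2_def F1_def F_def)
    then show ?thesis using conv by (simp only: eval_cfps[OF that] disc_conv_intros) simp
  qed
  have q_bounds: "x * eval_fps q x \<le> 1" "\<delta> * eval_fps q x \<le> a * b" if x: "0 \<le> x" "x < 1" for x
  proof -
    have nx: "norm (complex_of_real x) < 1" "\<bar>x\<bar> < 1" using x by auto
    note real = eval_cfps_real[OF _ nx(2)]
    let ?r = "\<lambda>P. eval_fps P x"
    have ge0: "?r P \<ge> 0" if "\<And>n. fps_nth P n \<ge> 0" "disc_conv P" for P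
      using eval_fps_ge_nth_0[OF that x] that(1)[of 0] by linarith
    have pos: "?r F \<ge> 0" "?r F1 \<ge> 0" "?r F2 \<ge> 0" using nonneg conv by (auto intro: ge0)
    have "?r S \<ge> 1"
      using eval_fps_ge_nth_0[of S x] nonneg conv x by (simp add: S_def)
    have "complex_of_real (?r q * ?r S) = of_real (?r F1)"
      using qS[OF nx(1)] q_conv conv by (simp add: real)
    then have 1: "?r q * ?r S = ?r F1" unfolding of_real_eq_iff .
    have "complex_of_real (?r S) = of_real (?r F + x * ?r F1)"
      using SF[OF nx(1)] conv by (simp add: real)
    then have 2: "?r S = ?r F + x * ?r F1" unfolding of_real_eq_iff .
    have "complex_of_real (?r S1) = of_real (2 * ?r F1 + x * ?r F2)"
      using S1F[OF nx(1)] conv by (simp add: real)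
    then have 3: "?r S1 = 2 * ?r F1 + x * ?r F2" unfolding of_real_eq_iff .
    have "complex_of_real ((1 - x) * ?r S1) = of_real ((1 - a) * (1 - b) * (1 - x) * ?r F1
        + a * b * ?r S - \<delta> * ?r F1)"
      using ode[OF nx(1)] conv by (simp add: real)
    then have 4: "(1 - x) * ?r S1 = (1 - a) * (1 - b) * (1 - x) * ?r F1 + a * b * ?r S - \<delta> * ?r F1"
      unfolding of_real_eq_iff .
    have "(1 - x * ?r q) * ?r S = ?r F"
      unfolding left_diff_distrib mult.assoc 1 using 2 by simp
    with pos(1) have "(1 - x * ?r q) * ?r S \<ge> 0" by simp
    with \<open>?r S \<ge> 1\<close> show "x * ?r q \<le> 1" by (simp add: zero_le_mult_iff)
    have "(a * b - \<delta> * ?r q) * ?r S = (1 - x) * (?r S1 - (1 - a) * (1 - b) * ?r F1)"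
      unfolding left_diff_distrib mult.assoc 1 using 4 by (simp add: algebra_simps)
    also have "\<dots> \<ge> 0"
    proof -
      have "(1 - a) * (1 - b) \<le> 1 * 1" using a b by (intro mult_mono) auto
      then have "(1 - a) * (1 - b) * ?r F1 \<le> 2 * ?r F1" using pos by (intro mult_right_mono) auto
      moreover have "x * ?r F2 \<ge> 0" using pos x by simp
      ultimately show ?thesis using 3 x by (intro mult_nonneg_nonneg) auto
    qed
    finally show "\<delta> * ?r q \<le> a * b"
      using \<open>?r S \<ge> 1\<close> by (simp add: zero_le_mult_iff)
  qed
  have q_norm: "norm (?e q z) \<le> eval_fps q (norm z)" if "norm z < 1" for z
    using nonneg(5) disc_conv_less[OF q_conv that] by (rule norm_eval_cfps_le)
  have zq: "norm (z * ?e q z) \<le> 1" if z: "norm z < 1" for z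
  proof -
    have "norm (z * ?e q z) \<le> norm z * eval_fps q (norm z)"
      unfolding norm_mult by (intro mult_left_mono q_norm z) auto
    also have "\<dots> \<le> 1" using q_bounds(1)[of "norm z"] z by simp
    finally show ?thesis .
  qed
  have \<delta>q: "norm (of_real \<delta> * ?e q z) \<le> a * b" if z: "norm z < 1" for z
  proof -
    have "norm (of_real \<delta> * ?e q z) \<le> \<delta> * eval_fps q (norm z)"
      using \<delta> by (simp add: norm_mult mult_left_mono q_norm z)
    also have "\<dots> \<le> a * b" using q_bounds(2)[of "norm z"] z by simp
    finally show ?thesis .
  qed
  have hol_q: "?e q holomorphic_on ball 0 1" by (rule holomorphic_eval_cfps[OF q_conv])
  have Cayley: "Re ((1 + z) / (1 - z) * (of_real (a * b) - of_real \<delta> * ?e q z)) \<ge> 0" if "norm z < 1" for z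
  proof (rule Re_Cayley_Pick_nonneg[OF _ _ _ _ that])
    show "(\<lambda>z. of_real \<delta> * ?e q z) holomorphic_on ball 0 1"
      by (intro holomorphic_intros hol_q)
    show "Im w * Im (of_real \<delta> * ?e q w) \<ge> 0" if w: "norm w < 1" for w
    proof -
      have up: "Im (?e q v) \<ge> 0" if "norm v < 1" "Im v > 0" for v
        unfolding q_def by (rule deriv_quotient_Pick[OF dq that])
      have "Im w * Im (?e q w) \<ge> 0"
      proof (cases "Im w" "0::real" rule: linorder_cases)
        case less
        then have "Im (?e q (cnj w)) \<ge> 0" using w by (intro up) auto
        with less show ?thesis using eval_cfps_cnj[OF q_conv w] by (simp add: zero_le_mult_iff)
      next
        case greater
        with up[OF w] show ?thesis by simp
      qed simp
      with \<delta> have "\<delta> * (Im w * Im (?e q w)) \<ge> 0" by (rule mult_nonneg_nonneg)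
      then show ?thesis by (simp add: mult_ac)
    qed
    fix x :: real assume x: "0 \<le> x" "x < 1"
    then show "Im (of_real \<delta> * ?e q (of_real x)) = 0" "Re (of_real \<delta> * ?e q (of_real x)) \<le> a * b"
      using q_bounds(2)[OF x] q_conv by (simp_all add: eval_cfps_real)
  qed
  \<comment> \<open>the logarithmic derivative of \<open>(z F)'\<close>, by the differential equation\<close>
  define Q where "Q z = of_real ((1 - a) * (1 - b)) * ?e q z + (of_real (a * b) - of_real \<delta> * ?e q z) / (1 - z)" for z
  have Q_hol: "Q holomorphic_on ball 0 1"
    unfolding Q_def by (intro holomorphic_intros hol_q) auto
  have S1_eq: "?e S1 z = Q z * ?e S z" if z: "norm z < 1" for z
  proof -
    have z1: "1 - z \<noteq> 0" using z by auto
    have "(1 - z) * ?e S1 z = (1 - z) * (Q z * ?e S z)"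
      unfolding ode[OF z] qS[OF z, symmetric] Q_def using z1
      by (simp add: divide_simps) (simp add: algebra_simps)
    with z1 show ?thesis by simp
  qed
  have S_nz: "?e S z \<noteq> 0" if "norm z < 1" for z
  proof (rule linear_ode_no_zero[OF Q_hol _ _ that])
    show "(?e S has_field_derivative Q z * ?e S z) (at z)" if "norm z < 1" for z
      using DERIV_eval_cfps[OF conv(4) that] S1_eq[OF that] by (simp add: S1_def)
    show "?e S 0 \<noteq> 0" by (simp add: eval_fps_at_0 S_def)
  qed
  let ?f = "shifted_hyp2f1 a b c"
  have norm_an: "normalized_analytic ?f"
    by (rule normalized_analytic_shifted_hyp2f1[OF params])
  then have hol: "?f holomorphic_on ball 0 1" by (simp add: normalized_analytic_def)
  have reg: "deriv ?f z \<noteq> 0" if "norm z < 1" for z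
    using S_nz[OF that] by (simp add: deriv_shifted_hyp2f1(1)[OF params that] S_def)
  have curv: "Re (1 + z * deriv (deriv ?f) z / deriv ?f z) > 0" if z: "norm z < 1" for z
  proof -
    define g where "g = of_real (a * b) - of_real \<delta> * ?e q z"
    have Re_of_real_mult: "Re (of_real r * w) = r * Re w" for r w by simp
    have z1: "1 - z \<noteq> 0" using z by auto
    have "deriv (deriv ?f) z / deriv ?f z = Q z"
      using S_nz[OF z] S1_eq[OF z]
      by (simp only: deriv_shifted_hyp2f1[OF params z] S_def [symmetric] S1_def [symmetric]) simp
    then have "1 + z * deriv (deriv ?f) z / deriv ?f z = 1 + z * Q z" by (metis times_divide_eq_right)
    \<comment> \<open>\<open>z / (1 - z)\<close> is half of \<open>(1 + z) / (1 - z)\<close> minus one half\<close>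
    also have "\<dots> = 1 + of_real ((1 - a) * (1 - b)) * (z * ?e q z)
        - of_real (1 / 2) * g + of_real (1 / 2) * ((1 + z) / (1 - z) * g)"
      unfolding Q_def g_def [symmetric] using z1 by (simp add: divide_simps) (simp add: algebra_simps)
    finally have eq: "Re (1 + z * deriv (deriv ?f) z / deriv ?f z) =
        1 + (1 - a) * (1 - b) * Re (z * ?e q z) - 1 / 2 * Re g + 1 / 2 * Re ((1 + z) / (1 - z) * g)"
      by (simp only: Re_complex_of_real plus_complex.sel minus_complex.sel one_complex.sel Re_of_real_mult)
    have "- 1 \<le> Re (z * ?e q z)"
      using zq[OF z] abs_Re_le_cmod[of "z * ?e q z"] by linarith
    then have "(1 - a) * (1 - b) * (- 1) \<le> (1 - a) * (1 - b) * Re (z * ?e q z)"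
      using a b by (intro mult_left_mono) auto
    moreover have "Re g \<le> 2 * (a * b)"
    proof -
      have "Re g = a * b - Re (of_real \<delta> * ?e q z)"
        by (simp only: g_def minus_complex.sel Re_complex_of_real)
      then show ?thesis
        using \<delta>q[OF z] abs_Re_le_cmod[of "of_real \<delta> * ?e q z"] by linarith
    qed
    moreover note Cayley[OF z, folded g_def]
    moreover have "1 + (1 - a) * (1 - b) * (- 1) - a * b = (a - a * b) + (b - a * b)"
      by (simp add: algebra_simps)
    ultimately show ?thesis unfolding eq using ab by linarith
  qed
  have inj: "inj_on ?f (ball 0 1)" by (rule injective_if_curvature_pos[OF hol reg curv])
  have cvx: "convex (?f ` ball 0 1)" by (rule convex_image_if_curvature_pos[OF hol reg curv])
  have "open (?f ` ball 0 1)" by (rule open_mapping_thm3[OF hol open_ball inj])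
  with norm_an inj cvx show ?thesis
    by (simp add: convex_function_def convex_connected)
qed

section \<open>Necessary conditions for a convex image\<close>

text \<open>
  A convex image contains the midpoint of \<open>f (w exp (\<i> t))\<close> and \<open>f (w exp (- \<i> t))\<close>, and composing
  with the inverse of \<open>f\<close> gives, for each real \<open>t\<close>, a self-map of the disc that fixes 0. By Schwarz'
  lemma these maps do not increase norms, and for \<open>t = 0\<close> the map is the identity. So at a fixed \<open>w = z\<close> the
  norm of the value is largest for \<open>t = 0\<close>. The second derivative of the value in \<open>t\<close> is \<open>- z R(z)\<close> there,
  and the second derivative test gives \<open>Re R(z) \<ge> 0\<close>.
\<close>

lemma convex_imp_curvature_nonneg:
  fixes f :: "complex \<Rightarrow> complex"
  assumes hol: "f holomorphic_on ball 0 1" and inj: "inj_on f (ball 0 1)"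
    and cvx: "convex (f ` ball 0 1)" and z: "norm z < 1"
  shows "Re (1 + z * deriv (deriv f) z / deriv f z) \<ge> 0"
proof (rule ccontr)
  assume neg: "\<not> ?thesis"
  then have z0: "z \<noteq> 0" by auto
  have opn: "open (f ` ball 0 1)" by (rule open_mapping_thm3[OF hol open_ball inj])
  obtain g where g: "g holomorphic_on f ` ball 0 1"
    "\<And>w. w \<in> ball 0 1 \<Longrightarrow> deriv f w * deriv g (f w) = 1" "\<And>w. w \<in> ball 0 1 \<Longrightarrow> g (f w) = w"
    by (rule holomorphic_has_inverse[OF hol open_ball inj], rule that)
  have df: "(f has_field_derivative deriv f w) (at w)" if "norm w < 1" for w
    using that by (intro holomorphic_derivI[OF hol]) auto
  have ddf: "(deriv f has_field_derivative deriv (deriv f) w) (at w)" if "norm w < 1" for w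
    using that by (intro holomorphic_derivI[OF holomorphic_deriv[OF hol]]) auto
  have dg: "(g has_field_derivative deriv g w) (at w)" if "w \<in> f ` ball 0 1" for w
    using that opn by (intro holomorphic_derivI[OF g(1)]) auto
  have ddg: "(deriv g has_field_derivative deriv (deriv g) w) (at w)" if "w \<in> f ` ball 0 1" for w
    using that opn by (intro holomorphic_derivI[OF holomorphic_deriv[OF g(1)]]) auto
  define mid where "mid w s = (f (w * exp (\<i> * s)) + f (w * exp (- (\<i> * s)))) / 2" for w s :: complex
  have nrm: "norm (exp (\<i> * of_real t)) = 1" "norm (exp (- (\<i> * of_real t))) = 1" for t
    by simp_all
  have mid_in: "mid w (of_real t) \<in> f ` ball 0 1" if w: "norm w < 1" for w t
  proof -
    have "f (w * exp (\<i> * of_real t)) \<in> f ` ball 0 1" "f (w * exp (- (\<i> * of_real t))) \<in> f ` ball 0 1"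
      using w by (auto simp: norm_mult)
    from convexD[OF cvx this, of "1/2" "1/2"] show ?thesis
      by (simp add: mid_def scaleR_conv_of_real add_divide_distrib)
  qed
  have Schwarz: "norm (g (mid z (of_real t))) \<le> norm z" for t
  proof (rule Schwarz_Lemma(1)[OF _ _ _ z])
    have rot: "(\<lambda>w. f (w * u)) holomorphic_on ball 0 1" if "norm u = 1" for u
    proof -
      have "(\<lambda>w. w * u) holomorphic_on ball 0 1" by (intro holomorphic_intros)
      from holomorphic_on_compose_gen[OF this hol] show ?thesis
        using that by (simp add: o_def norm_mult image_subset_iff)
    qed
    show "(\<lambda>w. g (mid w (of_real t))) holomorphic_on ball 0 1"
    proof -
      have "(\<lambda>w. mid w (of_real t)) holomorphic_on ball 0 1"
        unfolding mid_def by (intro holomorphic_intros rot nrm) simp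
      from holomorphic_on_compose_gen[OF this g(1)] show ?thesis
        using mid_in by (simp add: o_def image_subset_iff)
    qed
    show "g (mid 0 (of_real t)) = 0" using g(3)[of 0] by (simp add: mid_def)
    show "norm (g (mid w (of_real t))) < 1" if "norm w < 1" for w
      using mid_in[OF that, of t] g(3) by auto
  qed
  define m m' where "m = mid z" and "m' s = (deriv f (z * exp (\<i> * s)) * (z * exp (\<i> * s)) * \<i>
      - deriv f (z * exp (- (\<i> * s))) * (z * exp (- (\<i> * s))) * \<i>) / 2" for s :: complex
  define m2 where "m2 = - (deriv (deriv f) z * z * z + deriv f z * z)"
  have dm: "(m has_field_derivative m' (of_real t)) (at (of_real t))" for t :: real
  proof -
    have n: "norm (z * exp (\<i> * of_real t)) < 1" "norm (z * exp (- (\<i> * of_real t))) < 1"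
      using z by (simp_all add: norm_mult)
    have e: "((\<lambda>s. z * exp (\<i> * s)) has_field_derivative z * exp (\<i> * of_real t) * \<i>) (at (of_real t))"
      "((\<lambda>s. z * exp (- (\<i> * s))) has_field_derivative - (z * exp (- (\<i> * of_real t)) * \<i>)) (at (of_real t))"
      by (auto intro!: derivative_eq_intros)
    show ?thesis
      unfolding m_def mid_def m'_def
      by (rule DERIV_cong[OF DERIV_cdivide[OF DERIV_add[OF DERIV_chain2[OF df[OF n(1)] e(1)]
              DERIV_chain2[OF df[OF n(2)] e(2)]]]]) (simp add: mult_ac)
  qed
  have m'0: "m' 0 = 0" by (simp add: m'_def)
  have m0: "m 0 = f z" by (simp add: m_def mid_def)
  have dm': "(m' has_field_derivative m2) (at 0)"
  proof -
    have z': "norm (z * exp (\<i> * 0)) < 1" "norm (z * exp (- (\<i> * 0))) < 1" using z by simp_all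
    have e: "((\<lambda>s. z * exp (\<i> * s)) has_field_derivative z * \<i>) (at 0)"
      "((\<lambda>s. z * exp (- (\<i> * s))) has_field_derivative - (z * \<i>)) (at 0)"
      by (auto intro!: derivative_eq_intros)
    show ?thesis
      unfolding m'_def m2_def
      by (rule DERIV_cong[OF DERIV_cdivide[OF DERIV_diff[OF
             DERIV_cmult_right[OF DERIV_mult[OF DERIV_chain2[OF ddf[OF z'(1)] e(1)] e(1)]]
             DERIV_cmult_right[OF DERIV_mult[OF DERIV_chain2[OF ddf[OF z'(2)] e(2)] e(2)]]]]])
         (simp add: field_simps)
  qed
  \<comment> \<open>\<open>U t \<le> \<bar>z\<bar>\<^sup>2 = U 0\<close> by Schwarz' lemma; \<open>V\<close> is the derivative of \<open>U\<close>.\<close>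
  define U V where "U t = Re (cnj z * g (m (of_real t)))"
    and "V t = Re (cnj z * (deriv g (m (of_real t)) * m' (of_real t)))" for t :: real
  have dU: "(U has_real_derivative V t) (at t)" for t
    unfolding U_def V_def
    by (rule has_real_derivative_Re_of_real[OF DERIV_cmult[OF DERIV_chain2[OF dg dm]]])
       (simp add: m_def mid_in z)
  have dV: "(V has_real_derivative Re (cnj z * (deriv g (f z) * m2))) (at 0)"
  proof -
    have fz: "m 0 \<in> f ` ball 0 1" using z m0 by auto
    have d0: "(m has_field_derivative m' 0) (at 0)" using dm[of 0] by simp
    have "((\<lambda>s. cnj z * (deriv g (m s) * m' s)) has_field_derivative
        cnj z * (deriv g (f z) * m2)) (at (of_real 0))"
      unfolding of_real_0
      by (rule DERIV_cong[OF DERIV_cmult[OF DERIV_mult[OF DERIV_chain2[OF ddg[OF fz] d0] dm']]])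
         (simp add: m'0 m0)
    from has_real_derivative_Re_of_real[OF this] show ?thesis unfolding V_def .
  qed
  have Re_rmult: "Re (of_real r * w) = r * Re w" for r w by simp
  have "deriv f z * deriv g (f z) = 1" using g(2) z by simp
  moreover from this have fz0: "deriv f z \<noteq> 0" by auto
  ultimately have dgz: "deriv g (f z) = 1 / deriv f z"
    by (simp add: eq_divide_eq mult.commute)
  have "cnj z * (deriv g (f z) * m2) = - (of_real ((norm z)\<^sup>2) * (1 + z * deriv (deriv f) z / deriv f z))"
    unfolding dgz m2_def complex_norm_square using fz0 by (simp add: field_simps)
  then have "Re (cnj z * (deriv g (f z) * m2)) = - ((norm z)\<^sup>2 * Re (1 + z * deriv (deriv f) z / deriv f z))"
    by (simp only: uminus_complex.sel Re_rmult)
  also have "\<dots> > 0" using neg z0 by (simp add: mult_pos_neg)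
  finally have "Re (cnj z * (deriv g (f z) * m2)) > 0" .
  from DERIV_pos_inc_right[OF dV this]
  obtain d where d: "d > 0" "\<And>h. 0 < h \<Longrightarrow> h < d \<Longrightarrow> V 0 < V (0 + h)" by blast
  have V0: "V 0 = 0" by (simp add: V_def m'0)
  have "U 0 < U (d / 2)"
  proof (rule DERIV_pos_imp_increasing_open[where f = U])
    show "\<exists>y. (U has_real_derivative y) (at t) \<and> y > 0" if "0 < t" "t < d / 2" for t
      using dU[of t] d(2)[of t] that V0 by auto
    show "continuous_on {0..d / 2} U"
      by (intro continuous_at_imp_continuous_on ballI DERIV_isCont[OF dU])
  qed (use d in simp)
  moreover have "U (d / 2) \<le> (norm z)\<^sup>2"
  proof -
    have "U (d / 2) \<le> norm (cnj z * g (m (of_real (d / 2))))"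
      unfolding U_def by (rule complex_Re_le_cmod)
    also have "\<dots> \<le> norm z * norm z"
      unfolding norm_mult m_def complex_mod_cnj by (intro mult_left_mono Schwarz) simp
    finally show ?thesis by (simp add: power2_eq_square)
  qed
  moreover have "U 0 = (norm z)\<^sup>2"
    using g(3)[of z] z unfolding U_def by (simp add: m0 cmod_power2) (simp add: power2_eq_square)
  ultimately show False by simp
qed

text \<open>
  A radial form of Julia's lemma: \<open>p x (1 - x) / (1 + x)\<close> does not increase on \<open>[0, 1)\<close>. It is Schwarz' lemma for
  \<open>(p \<circ> T - p x) / (p \<circ> T + p x)\<close>, where \<open>T\<close> is the automorphism of the disc that takes 0 to \<open>x\<close>, evaluated
  at the point \<open>\<eta>\<close> with \<open>T \<eta> = y\<close>.
\<close>

lemma Julia_radial: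
  fixes p :: "complex \<Rightarrow> complex"
  assumes hol: "p holomorphic_on ball 0 1" and pos: "\<And>z. norm z < 1 \<Longrightarrow> Re (p z) > 0"
    and real: "\<And>x. 0 \<le> x \<Longrightarrow> x < 1 \<Longrightarrow> Im (p (of_real x)) = 0"
    and xy: "0 \<le> x" "x < y" "y < 1"
  shows "Re (p (of_real y)) * (1 - y) * (1 + x) \<le> Re (p (of_real x)) * (1 + y) * (1 - x)"
proof -
  define P where "P = Re (p (of_real x))"
  have P: "P > 0" "p (of_real x) = of_real P"
    using pos[of "of_real x"] real[of x] xy by (auto simp: P_def complex_eq_iff)
  define T where "T w = (w + of_real x) / (1 + of_real x * w)" for w :: complex
  have den: "1 + of_real x * w \<noteq> 0" if "norm w < 1" for w :: complex
  proof
    assume "1 + of_real x * w = 0"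
    then have "of_real x * w = -1" by (simp add: eq_neg_iff_add_eq_0 add.commute)
    then have "norm (of_real x * w) = 1" by simp
    moreover have "norm (of_real x * w) < 1"
      using xy that by (simp add: norm_mult) (meson le_less_trans less_imp_le mult_left_le norm_ge_zero)
    ultimately show False by simp
  qed
  have T: "norm (T w) < 1" if w: "norm w < 1" for w
  proof -
    have "(norm (1 + of_real x * w))\<^sup>2 - (norm (w + of_real x))\<^sup>2 = (1 - (norm w)\<^sup>2) * (1 - x\<^sup>2)"
      by (simp add: cmod_power2) (simp add: power2_eq_square algebra_simps)
    also have "\<dots> > 0" using w xy by (intro mult_pos_pos) (auto simp: power_less_one_iff abs_square_less_1)
    finally have "(norm (w + of_real x))\<^sup>2 < (norm (1 + of_real x * w))\<^sup>2" by simp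
    then have "norm (w + of_real x) < norm (1 + of_real x * w)"
      by (rule power2_less_imp_less) simp
    then show ?thesis using den[OF w] by (simp add: T_def norm_divide)
  qed
  have less: "norm (v - of_real P) < norm (v + of_real P)" if "Re v > 0" for v
  proof -
    have "(norm (v + of_real P))\<^sup>2 - (norm (v - of_real P))\<^sup>2 = 4 * P * Re v"
      by (simp add: cmod_power2) (simp add: power2_eq_square algebra_simps)
    also have "\<dots> > 0" using that P by simp
    finally have "(norm (v - of_real P))\<^sup>2 < (norm (v + of_real P))\<^sup>2" by simp
    then show ?thesis by (rule power2_less_imp_less) simp
  qed
  define h where "h w = (p (T w) - of_real P) / (p (T w) + of_real P)" for w
  define \<eta> where "\<eta> = (y - x) / (1 - x * y)"
  have "x * y \<le> 1 * y" using xy by (intro mult_right_mono) auto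
  then have xy1: "x * y < 1" using xy by linarith
  have \<eta>: "0 < \<eta>" "\<eta> < 1" "1 - \<eta> = (1 - y) * (1 + x) / (1 - x * y)" "1 + \<eta> = (1 + y) * (1 - x) / (1 - x * y)"
  proof -
    have "0 < (1 - y) * (1 + x)" using xy by simp
    then have "y + x * y < 1 + x" by (simp add: algebra_simps)
    then show "0 < \<eta>" "\<eta> < 1" "1 - \<eta> = (1 - y) * (1 + x) / (1 - x * y)" "1 + \<eta> = (1 + y) * (1 - x) / (1 - x * y)"
      using xy xy1 by (simp_all add: \<eta>_def divide_simps) (simp_all add: algebra_simps)
  qed
  have h\<eta>: "norm (h (of_real \<eta>)) \<le> norm (complex_of_real \<eta>)"
  proof (rule Schwarz_Lemma(1))
    have "T holomorphic_on ball 0 1"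
      unfolding T_def[abs_def] using den by (intro holomorphic_intros) auto
    from holomorphic_on_compose_gen[OF this hol]
    have "(\<lambda>w. p (T w)) holomorphic_on ball 0 1" using T by (simp add: o_def image_subset_iff)
    moreover have "p (T w) + of_real P \<noteq> 0" if "norm w < 1" for w
      using less[OF pos[OF T[OF that]]] by auto
    ultimately show "h holomorphic_on ball 0 1"
      unfolding h_def by (intro holomorphic_intros) auto
    show "h 0 = 0" using P by (simp add: h_def T_def)
    show "norm (h w) < 1" if "norm w < 1" for w
    proof -
      note l = less[OF pos[OF T[OF that]]]
      have "0 < norm (p (T w) + of_real P)" by (rule le_less_trans[OF norm_ge_zero l])
      with l show ?thesis by (simp only: h_def norm_divide divide_less_eq_1_pos)
    qed
    show "norm (complex_of_real \<eta>) < 1" using \<eta> by simp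
  qed
  define Y where "Y = Re (p (of_real y))"
  have T\<eta>: "T (of_real \<eta>) = of_real y"
  proof -
    have "T (of_real \<eta>) = of_real ((\<eta> + x) / (1 + x * \<eta>))" by (simp add: T_def)
    also have "(\<eta> + x) / (1 + x * \<eta>) = y"
    proof -
      have "1 + x * \<eta> > 0" using \<eta> xy by (intro add_pos_nonneg) auto
      moreover have "\<eta> * (1 - x * y) = y - x" using xy1 by (simp add: \<eta>_def)
      ultimately show ?thesis by (simp add: divide_eq_eq algebra_simps)
    qed
    finally show ?thesis .
  qed
  have Y: "Y > 0" "p (of_real y) = of_real Y"
    using pos[of "of_real y"] real[of y] xy by (auto simp: Y_def complex_eq_iff)
  have "norm ((of_real Y - of_real P) / (of_real Y + of_real P) :: complex) \<le> \<eta>"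
    using h\<eta> \<eta>(1) unfolding h_def T\<eta> Y(2) by simp
  also have "(of_real Y - of_real P) / (of_real Y + of_real P) = complex_of_real ((Y - P) / (Y + P))"
    by simp
  finally have "(Y - P) / (Y + P) \<le> \<eta>" unfolding norm_of_real by linarith
  then have "Y * (1 - \<eta>) \<le> P * (1 + \<eta>)"
    using Y P by (simp add: pos_divide_le_eq) (simp add: algebra_simps)
  then have "Y * ((1 - y) * (1 + x)) / (1 - x * y) \<le> P * ((1 + y) * (1 - x)) / (1 - x * y)"
    unfolding \<eta>(3,4) by simp
  then have "Y * ((1 - y) * (1 + x)) \<le> P * ((1 + y) * (1 - x))"
    using xy1 by (simp add: divide_le_cancel)
  then show ?thesis unfolding Y_def P_def by (simp add: mult.assoc)
qed

section \<open>Boundary behaviour and failure of convexity\<close>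

text \<open>
  If \<open>P\<close> tends to infinity at 1, every initial segment of its series is negligible against it, and beyond
  the \<open>N\<close>th term the weights \<open>1 / (c + n)\<close> are at most \<open>1 / (c + N)\<close>.
\<close>

lemma power_series_ratio_tendsto_0:
  fixes P :: "real fps" and c :: real
  assumes nonneg: "\<And>n. fps_nth P n \<ge> 0" and conv: "disc_conv P" and c: "c > 0"
    and top: "filterlim (eval_fps P) at_top (at_left 1)"
  defines "E \<equiv> Abs_fps (\<lambda>n. fps_nth P n / (c + real n))"
  shows "((\<lambda>x. eval_fps E x / eval_fps P x) \<longlongrightarrow> 0) (at_left 1)"
proof (rule tendstoI)
  fix \<epsilon> :: real assume \<epsilon>: "\<epsilon> > 0"
  obtain N :: nat where N: "2 / \<epsilon> < real N" using reals_Archimedean2 by blast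
  have cN: "c + real N > 0" "1 / (c + real N) < \<epsilon> / 2"
  proof -
    show 1: "c + real N > 0" using c by simp
    have "2 / \<epsilon> < c + real N" using N c by linarith
    with 1 \<epsilon> show "1 / (c + real N) < \<epsilon> / 2" by (simp add: field_simps)
  qed
  define K where "K = (\<Sum>n<N. fps_nth P n / c)"
  have E_nonneg: "fps_nth E n \<ge> 0" for n using nonneg c by (simp add: E_def)
  have "fps_nth E n \<le> fps_nth (fps_const (1 / c) * P) n" for n
    using nonneg[of n] c by (simp add: E_def frac_le)
  then have conv_E: "disc_conv E"
    by (rule disc_conv_mono[OF E_nonneg]) (intro disc_conv_intros conv)
  have bound: "eval_fps E x \<le> K + eval_fps P x / (c + real N)" if x: "0 \<le> x" "x < 1" for x
  proof -
    have nx: "norm x < 1" using x by simp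
    have sE: "(\<lambda>n. fps_nth E n * x ^ n) sums eval_fps E x"
      using disc_conv_less[OF conv_E, of x] nx by (intro sums_eval_fps) simp
    have sP: "(\<lambda>n. fps_nth P n * x ^ n) sums eval_fps P x"
      using disc_conv_less[OF conv, of x] nx by (intro sums_eval_fps) simp
    have sK: "(\<lambda>n. if n \<in> {..<N} then fps_nth P n / c else 0) sums K"
      unfolding K_def by (rule sums_If_finite_set) simp
    have "fps_nth E n * x ^ n \<le> (if n \<in> {..<N} then fps_nth P n / c else 0) + fps_nth P n * x ^ n / (c + real N)" for n
    proof (cases "n < N")
      case True
      have "fps_nth E n * x ^ n \<le> fps_nth P n / c * 1"
        using nonneg[of n] c x by (intro mult_mono) (auto simp: E_def frac_le power_le_one)
      also have "\<dots> \<le> fps_nth P n / c + fps_nth P n * x ^ n / (c + real N)"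
        using nonneg[of n] cN x by simp
      finally show ?thesis using True by simp
    next
      case False
      have "fps_nth P n / (c + real n) \<le> fps_nth P n / (c + real N)"
        using nonneg[of n] cN c False by (intro divide_left_mono mult_pos_pos) auto
      then have "fps_nth E n * x ^ n \<le> fps_nth P n / (c + real N) * x ^ n"
        using x by (intro mult_right_mono) (auto simp: E_def)
      with False show ?thesis by simp
    qed
    from sums_le[OF this sE sums_add[OF sK sums_divide[OF sP]]] show ?thesis .
  qed
  have "eventually (\<lambda>x. eval_fps P x > 2 * K / \<epsilon> \<and> eval_fps P x > 0) (at_left 1)"
    using top by (intro eventually_conj) (auto simp: filterlim_at_top_dense)
  moreover have "eventually (\<lambda>x. x \<in> {0<..<1::real}) (at_left 1)"
    by (rule eventually_at_left_real) simp
  ultimately show "eventually (\<lambda>x. dist (eval_fps E x / eval_fps P x) 0 < \<epsilon>) (at_left 1)"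
  proof eventually_elim
    case (elim x)
    then have P: "eval_fps P x > 0" "K < \<epsilon> / 2 * eval_fps P x" and x: "0 \<le> x" "x < 1"
      using \<epsilon> by (auto simp: field_simps)
    have "eval_fps E x \<le> K + eval_fps P x / (c + real N)" by (rule bound[OF x])
    also have "eval_fps P x / (c + real N) < \<epsilon> / 2 * eval_fps P x"
      using mult_strict_right_mono[OF cN(2) P(1)] by simp
    finally have "eval_fps E x < \<epsilon> * eval_fps P x" using P(2) by simp
    moreover have "eval_fps E x \<ge> 0"
      using x disc_conv_less[OF conv_E, of x] by (intro eval_fps_nonneg E_nonneg) auto
    ultimately show ?case using P(1) by (simp add: divide_less_eq)
  qed
qed

text \<open>
  The first-order equation \<open>(1 - z) F' = s F + E\<close> with \<open>s = a + b - c\<close>: the inhomogeneity \<open>E\<close> has smaller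
  coefficients than \<open>F\<close> by a factor of order \<open>1 / n\<close>, so if \<open>s > 0\<close> then near 1 the function \<open>F\<close> has
  nearly the logarithmic derivative \<open>s / (1 - z)\<close>.
\<close>

lemma one_minus_X_deriv_hyp:
  assumes "c > 0"
  shows "(1 - fps_X) * fps_deriv (hyp a b c) = fps_const (a + b - c) * hyp a b c
    + fps_const ((c - a) * (c - b)) * Abs_fps (\<lambda>n. fps_nth (hyp a b c) n / (c + real n))"
proof (rule fps_ext)
  fix n
  note [simp del] = fps_hypergeo_nth
  have cn: "c + real n > 0" using assms by simp
  have "(1 - fps_X) * G = G - fps_X * G" for G :: "real fps" by (simp add: algebra_simps)
  then have "fps_nth ((1 - fps_X) * fps_deriv (hyp a b c)) n =
      (1 + real n) * fps_nth (hyp a b c) (Suc n) - real n * fps_nth (hyp a b c) n"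
    by (cases n) (simp_all add: algebra_simps)
  also have "(1 + real n) * fps_nth (hyp a b c) (Suc n) =
      (a + real n) * (b + real n) * fps_nth (hyp a b c) n / (c + real n)"
    using hyp_Suc[OF assms, of n a b] cn by (simp add: field_simps)
  also have "(a + real n) * (b + real n) * fps_nth (hyp a b c) n / (c + real n) - real n * fps_nth (hyp a b c) n =
      (a + b - c) * fps_nth (hyp a b c) n + (c - a) * (c - b) * (fps_nth (hyp a b c) n / (c + real n))"
    using cn by (simp add: divide_simps) (simp add: algebra_simps)
  finally show "fps_nth ((1 - fps_X) * fps_deriv (hyp a b c)) n =
      fps_nth (fps_const (a + b - c) * hyp a b c
    + fps_const ((c - a) * (c - b)) * Abs_fps (\<lambda>n. fps_nth (hyp a b c) n / (c + real n))) n"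
    by simp
qed

lemma hyp_boundary_behaviour:
  assumes pos: "a > 0" "b > 0" "c > 0" and ac: "a \<le> c" "b \<le> c" and s: "a + b - c > 0"
  shows "filterlim (eval_fps (hyp a b c)) at_top (at_left 1)"
    and "((\<lambda>x. (1 - x) * eval_fps (fps_deriv (hyp a b c)) x / eval_fps (hyp a b c) x)
            \<longlongrightarrow> a + b - c) (at_left 1)"
proof -
  define F where "F = hyp a b c"
  define E where "E = Abs_fps (\<lambda>n. fps_nth F n / (c + real n))"
  define s where "s = a + b - c"
  have s: "s > 0" using assms by (simp add: s_def)
  have conv: "disc_conv F" unfolding F_def by (rule disc_conv_hyp[OF pos])
  have F_pos: "fps_nth F n \<ge> 0" for n unfolding F_def by (rule less_imp_le[OF hyp_pos[OF pos]])
  have E_pos: "fps_nth E n \<ge> 0" for n using F_pos pos by (simp add: E_def)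
  have "fps_nth E n \<le> fps_nth (fps_const (1 / c) * F) n" for n
    using F_pos[of n] pos by (simp add: E_def frac_le)
  then have conv_E: "disc_conv E"
    by (rule disc_conv_mono[OF E_pos]) (intro disc_conv_intros conv)
  have eq: "(1 - x) * eval_fps (fps_deriv F) x = s * eval_fps F x + (c - a) * (c - b) * eval_fps E x"
    if "\<bar>x\<bar> < 1" for x
  proof -
    have "eval_fps ((1 - fps_X) * fps_deriv F) x = eval_fps (fps_const s * F + fps_const ((c - a) * (c - b)) * E) x"
      unfolding F_def E_def s_def by (simp only: one_minus_X_deriv_hyp[OF pos(3)])
    then show ?thesis
      using that conv conv_E by (simp add: eval_disc_conv_real)
  qed
  have F_ge: "eval_fps F x \<ge> 1" if "0 \<le> x" "x < 1" for x
    using eval_fps_ge_nth_0[OF F_pos conv that] by (simp add: F_def)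
  have dF: "(eval_fps F has_real_derivative eval_fps (fps_deriv F) x) (at x)" if "\<bar>x\<bar> < 1" for x
    using that disc_conv_less[OF conv, of x] by (intro has_field_derivative_eval_fps) simp
  \<comment> \<open>\<open>F' \<ge> s F / (1 - x)\<close> and \<open>F \<ge> 1\<close>; integrate.\<close>
  have lower: "1 - s * ln (1 - x) \<le> eval_fps F x" if x: "0 < x" "x < 1" for x
  proof -
    have "eval_fps F 0 + s * ln (1 - 0) \<le> eval_fps F x + s * ln (1 - x)"
    proof (rule DERIV_nonneg_imp_nondecreasing[where f = "\<lambda>x. eval_fps F x + s * ln (1 - x)"])
      fix t assume t: "0 \<le> t" "t \<le> x"
      have "((\<lambda>x. eval_fps F x + s * ln (1 - x)) has_real_derivative
          eval_fps (fps_deriv F) t - s / (1 - t)) (at t)"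
      proof -
        have "((\<lambda>x. s * ln (1 - x)) has_real_derivative - s / (1 - t)) (at t)"
          using t x by (auto intro!: derivative_eq_intros)
        from DERIV_add[OF dF this] show ?thesis using t x by simp
      qed
      moreover have "s / (1 - t) \<le> eval_fps (fps_deriv F) t"
      proof -
        have "s * 1 \<le> s * eval_fps F t" using s F_ge[of t] t x by (intro mult_left_mono) auto
        also have "\<dots> \<le> (1 - t) * eval_fps (fps_deriv F) t"
        proof -
          have "eval_fps E t \<ge> 0"
            using t x disc_conv_less[OF conv_E, of t] by (intro eval_fps_nonneg E_pos) auto
          then show ?thesis using eq[of t] t x ac by simp
        qed
        finally show ?thesis using t x by (simp add: divide_simps mult.commute)
      qed
      ultimately show "\<exists>y. ((\<lambda>x. eval_fps F x + s * ln (1 - x)) has_real_derivative y) (at t) \<and> 0 \<le> y"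
        by auto
    qed (use x in simp)
    then show ?thesis by (simp add: eval_fps_at_0 F_def)
  qed
  have ev: "eventually (\<lambda>x. x \<in> {0<..<1::real}) (at_left 1)"
    by (rule eventually_at_left_real) simp
  have "filterlim (\<lambda>x. 1 - s * ln (1 - x)) at_top (at_left 1)"
    using s by real_asymp
  then show top: "filterlim (eval_fps (hyp a b c)) at_top (at_left 1)"
    unfolding F_def[symmetric]
    by (rule filterlim_at_top_mono) (use ev in \<open>eventually_elim, auto intro: lower\<close>)
  have "((\<lambda>x. eval_fps E x / eval_fps F x) \<longlongrightarrow> 0) (at_left 1)"
    unfolding E_def using F_pos conv pos(3) top[folded F_def] by (rule power_series_ratio_tendsto_0)
  then have "((\<lambda>x. s + (c - a) * (c - b) * (eval_fps E x / eval_fps F x)) \<longlongrightarrow> s + (c - a) * (c - b) * 0) (at_left 1)"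
    by (intro tendsto_intros)
  moreover have "eventually (\<lambda>x. s + (c - a) * (c - b) * (eval_fps E x / eval_fps F x) =
      (1 - x) * eval_fps (fps_deriv F) x / eval_fps F x) (at_left 1)"
    using ev
  proof eventually_elim
    case (elim x)
    with F_ge[of x] eq[of x] show ?case by (simp add: add_divide_distrib)
  qed
  ultimately have "((\<lambda>x. (1 - x) * eval_fps (fps_deriv F) x / eval_fps F x) \<longlongrightarrow> s + (c - a) * (c - b) * 0) (at_left 1)"
    by (rule Lim_transform_eventually)
  then show "((\<lambda>x. (1 - x) * eval_fps (fps_deriv (hyp a b c)) x / eval_fps (hyp a b c) x)
            \<longlongrightarrow> a + b - c) (at_left 1)"
    by (simp add: F_def s_def del: fps_hypergeo_nth)
qed

text \<open>
  The left-hand side of the conclusion is the constant \<open>\<kappa>\<close> in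
  \<open>R(x) = (1 + s) / 2 * (1 + x) / (1 - x) + \<kappa> + o(1)\<close> as \<open>x \<rightarrow> 1\<close>. Julia's lemma, with
  \<open>R(x) (1 - x) \<rightarrow> 1 + s\<close>, gives \<open>R(x) \<ge> (1 + s) / 2 * (1 + x) / (1 - x)\<close> for every \<open>x\<close>, whence \<open>\<kappa> \<ge> 0\<close>.
\<close>

lemma convex_imp_angular_constant_nonneg:
  fixes a b c :: real
  assumes pos: "a > 0" "b > 0" "c > 0" and ac: "a \<le> c" "b \<le> c" and s_pos: "a + b - c > 0"
    and convex: "convex_function (shifted_hyp2f1 a b c)"
  defines "s \<equiv> a + b - c"
  shows "2 - a - b + (1 + s) / 2 + (a * b - 1 - s) / s \<ge> 0"
proof (rule field_le_epsilon)
  fix \<epsilon> :: real assume \<epsilon>: "\<epsilon> > 0"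
  let ?f = "shifted_hyp2f1 a b c"
  define F F1 S S1 where "F = hyp a b c" and "F1 = fps_deriv F" and "S = shifted_deriv a b c" and "S1 = fps_deriv S"
  define \<delta> where "\<delta> = a * b - 1 - s"
  define k where "k = (1 - a) * (1 - b)"
  have s: "s > 0" using s_pos by (simp add: s_def)
  have conv: "disc_conv F" "disc_conv F1" "disc_conv S" "disc_conv S1"
    unfolding F_def F1_def S_def S1_def
    by (intro disc_conv_intros disc_conv_hyp disc_conv_shifted_deriv pos)+
  have nonneg: "fps_nth F n \<ge> 0" "fps_nth S n \<ge> 0" for n
    using less_imp_le[OF hyp_pos[OF pos]]
    by (simp_all add: F_def S_def shifted_deriv_nth del: fps_hypergeo_nth)
  have hol: "?f holomorphic_on ball 0 1" and inj: "inj_on ?f (ball 0 1)" and cvx: "Convex.convex (?f ` ball 0 1)"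
    using convex by (auto simp: convex_function_def normalized_analytic_def)
  have nz: "deriv ?f z \<noteq> 0" if "norm z < 1" for z
    using holomorphic_injective_imp_regular[OF hol open_ball inj] that by auto
  \<comment> \<open>Julia's lemma asks for a positive real part, so \<open>R\<close> is shifted by \<open>\<epsilon>\<close>.\<close>
  define p where "p z = 1 + z * deriv (deriv ?f) z / deriv ?f z + of_real \<epsilon>" for z
  define p' where "p' x = Re (p (of_real x))" for x
  have p_hol: "p holomorphic_on ball 0 1"
    unfolding p_def using nz by (intro holomorphic_intros hol) auto
  have p_pos: "Re (p z) > 0" if "norm z < 1" for z
    using convex_imp_curvature_nonneg[OF hol inj cvx that] \<epsilon> by (simp add: p_def)
  \<comment> \<open>The only part of \<open>R x\<close> that is not rational in \<open>x\<close>; it tends to \<open>1 / s\<close>.\<close>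
  define \<tau> where "\<tau> x = eval_fps F x / ((1 - x) * eval_fps S x)" for x
  have p_real: "p (of_real x) = of_real (2 - a - b + (1 + s) / (1 - x) + (\<delta> - k * (1 - x)) * \<tau> x + \<epsilon>)"
    if x: "0 \<le> x" "x < 1" for x
  proof -
    have nx: "norm (complex_of_real x) < 1" "\<bar>x\<bar> < 1" using x by auto
    note real = eval_cfps_real[OF _ nx(2)]
    have S_ge: "eval_fps S x \<ge> 1"
      using eval_fps_ge_nth_0[OF nonneg(2) conv(3) x] by (simp add: S_def)
    have "complex_of_real (eval_fps S x) = of_real (eval_fps F x + x * eval_fps F1 x)"
      using shifted_deriv_eval[OF pos nx(1), folded S_def F_def, folded F1_def] conv by (simp add: real)
    then have SF: "eval_fps S x = eval_fps F x + x * eval_fps F1 x" unfolding of_real_eq_iff .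
    have "complex_of_real ((1 - x) * eval_fps S1 x) =
        of_real (k * (1 - x) * eval_fps F1 x + a * b * eval_fps S x - (c - 1 - a - b + a * b) * eval_fps F1 x)"
      using shifted_deriv_ode_eval[OF pos nx(1), folded S_def F_def, folded S1_def F1_def] conv
      by (simp add: real k_def)
    then have ode: "(1 - x) * eval_fps S1 x = k * (1 - x) * eval_fps F1 x + a * b * eval_fps S x - \<delta> * eval_fps F1 x"
      unfolding of_real_eq_iff by (simp add: \<delta>_def s_def algebra_simps)
    have "p (of_real x) = of_real (1 + x * eval_fps S1 x / eval_fps S x + \<epsilon>)"
      using conv by (simp add: p_def deriv_shifted_hyp2f1[OF pos nx(1), folded S_def, folded S1_def] real)
    also have "1 + x * eval_fps S1 x / eval_fps S x =
        2 - a - b + (1 + s) / (1 - x) + (\<delta> - k * (1 - x)) * \<tau> x"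
    proof -
      define S' where "S' = eval_fps S x"
      have S': "S' > 0" "eval_fps F x = S' - x * eval_fps F1 x" using S_ge SF by (auto simp: S'_def)
      have e: "eval_fps S1 x = (k * (1 - x) * eval_fps F1 x + a * b * S' - \<delta> * eval_fps F1 x) / (1 - x)"
        using ode x by (simp add: field_simps S'_def)
      have k: "k = 1 - a - b + a * b" by (simp add: k_def algebra_simps)
      have \<delta>: "s = a * b - 1 - \<delta>" by (simp add: \<delta>_def)
      show ?thesis
        unfolding \<tau>_def S'_def[symmetric] e S'(2) k \<delta> using x S'(1)
        by (simp add: divide_simps) (simp add: algebra_simps)
    qed
    finally show ?thesis .
  qed
  have \<tau>_lim: "(\<tau> \<longlongrightarrow> 1 / s) (at_left 1)"
  proof -
    define u where "u x = (1 - x) * eval_fps F1 x / eval_fps F x" for x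
    have "(u \<longlongrightarrow> s) (at_left 1)"
      unfolding u_def F1_def F_def s_def by (rule hyp_boundary_behaviour(2)[OF pos ac s_pos])
    then have "((\<lambda>x. 1 / ((1 - x) + x * u x)) \<longlongrightarrow> 1 / ((1 - 1) + 1 * s)) (at_left 1)"
      using s by (intro tendsto_intros) auto
    moreover have "eventually (\<lambda>x. 1 / ((1 - x) + x * u x) = \<tau> x) (at_left 1)"
      using eventually_at_left_real[OF zero_less_one]
    proof eventually_elim
      case (elim x)
      then have x: "0 \<le> x" "x < 1" "norm (complex_of_real x) < 1" "\<bar>x\<bar> < 1" by auto
      have "eval_fps F x \<ge> 1"
        using eval_fps_ge_nth_0[OF nonneg(1) conv(1) x(1,2)] by (simp add: F_def)
      moreover have "eval_fps S x = eval_fps F x + x * eval_fps F1 x"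
        unfolding S_def shifted_deriv_def using conv x by (simp add: eval_disc_conv_real F_def F1_def)
      ultimately have "(1 - x) + x * u x = (1 - x) * eval_fps S x / eval_fps F x"
        by (simp add: u_def field_simps)
      then show ?case by (simp add: \<tau>_def)
    qed
    ultimately have "(\<tau> \<longlongrightarrow> 1 / ((1 - 1) + 1 * s)) (at_left 1)" by (rule Lim_transform_eventually)
    then show ?thesis by simp
  qed
  have ev: "eventually (\<lambda>x. x \<in> {y<..<1::real}) (at_left 1)" if "y < 1" for y
    by (rule eventually_at_left_real[OF that])
  have p'_eq: "p' x = 2 - a - b + (1 + s) / (1 - x) + (\<delta> - k * (1 - x)) * \<tau> x + \<epsilon>" if "0 \<le> x" "x < 1" for x
    unfolding p'_def p_real[OF that] by simp
  have limit: "((\<lambda>x. p' x * (1 - x)) \<longlongrightarrow> 1 + s) (at_left 1)"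
  proof -
    have "((\<lambda>x. (2 - a - b + \<epsilon>) * (1 - x) + (1 + s) + (\<delta> - k * (1 - x)) * \<tau> x * (1 - x)) \<longlongrightarrow>
        (2 - a - b + \<epsilon>) * (1 - 1) + (1 + s) + (\<delta> - k * (1 - 1)) * (1 / s) * (1 - 1)) (at_left 1)"
      by (intro tendsto_intros \<tau>_lim)
    moreover have "eventually (\<lambda>x. (2 - a - b + \<epsilon>) * (1 - x) + (1 + s) + (\<delta> - k * (1 - x)) * \<tau> x * (1 - x) = p' x * (1 - x)) (at_left 1)"
      using eventually_at_left_real[OF zero_less_one]
    proof eventually_elim
      case (elim x)
      then have x: "0 \<le> x" "1 - x \<noteq> 0" "x < 1" by auto
      have "(1 + s) / (1 - x) * (1 - x) = 1 + s" using x by simp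
      then show ?case unfolding p'_eq[OF x(1,3)] by (simp add: distrib_right)
    qed
    ultimately have "((\<lambda>x. p' x * (1 - x)) \<longlongrightarrow>
        (2 - a - b + \<epsilon>) * (1 - 1) + (1 + s) + (\<delta> - k * (1 - 1)) * (1 / s) * (1 - 1)) (at_left 1)"
      by (rule Lim_transform_eventually)
    then show ?thesis by simp
  qed
  have lower: "(1 + s) * (1 + x) \<le> p' x * 2 * (1 - x)" if x: "0 \<le> x" "x < 1" for x
  proof (rule tendsto_le)
    show "((\<lambda>y. p' y * (1 - y) * (1 + x)) \<longlongrightarrow> (1 + s) * (1 + x)) (at_left 1)"
      by (intro tendsto_intros limit)
    have "((\<lambda>y. p' x * (1 + y) * (1 - x)) \<longlongrightarrow> p' x * (1 + 1) * (1 - x)) (at_left 1)"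
      by (intro tendsto_intros)
    then show "((\<lambda>y. p' x * (1 + y) * (1 - x)) \<longlongrightarrow> p' x * 2 * (1 - x)) (at_left 1)" by simp
    show "eventually (\<lambda>y. p' y * (1 - y) * (1 + x) \<le> p' x * (1 + y) * (1 - x)) (at_left 1)"
      using ev[OF x(2)]
    proof eventually_elim
      case (elim y)
      then show ?case
        unfolding p'_def using x p_real by (intro Julia_radial[OF p_hol p_pos]) auto
    qed
  qed simp
  have "0 \<le> 2 - a - b + (1 + s) / 2 + \<epsilon> + (\<delta> - k * (1 - x)) * \<tau> x" if x: "0 \<le> x" "x < 1" for x
  proof -
    have "(1 + s) * (1 + x) / (2 * (1 - x)) \<le> p' x"
      using lower[OF x] x by (simp add: divide_simps mult_ac)
    moreover have "(1 + s) / (1 - x) - (1 + s) * (1 + x) / (2 * (1 - x)) = (1 + s) / 2"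
      using x by (simp add: divide_simps) (simp add: algebra_simps)
    ultimately show ?thesis unfolding p'_eq[OF x] by linarith
  qed
  then have "0 \<le> 2 - a - b + (1 + s) / 2 + \<epsilon> + (\<delta> - k * (1 - x)) * \<tau> x" if "x \<in> {0<..<1}" for x
    using that by simp
  with ev[OF zero_less_one]
  have "eventually (\<lambda>x. 0 \<le> 2 - a - b + (1 + s) / 2 + \<epsilon> + (\<delta> - k * (1 - x)) * \<tau> x) (at_left 1)"
    by (rule eventually_mono)
  moreover have "((\<lambda>x. 2 - a - b + (1 + s) / 2 + \<epsilon> + (\<delta> - k * (1 - x)) * \<tau> x) \<longlongrightarrow>
      2 - a - b + (1 + s) / 2 + \<epsilon> + (\<delta> - k * (1 - 1)) * (1 / s)) (at_left 1)"
    by (intro tendsto_intros \<tau>_lim)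
  ultimately have "0 \<le> 2 - a - b + (1 + s) / 2 + \<epsilon> + (\<delta> - k * (1 - 1)) * (1 / s)"
    by (intro tendsto_lowerbound[where F = "at_left (1::real)"]) simp_all
  then show "0 \<le> 2 - a - b + (1 + s) / 2 + (a * b - 1 - s) / s + \<epsilon>"
    by (simp add: \<delta>_def)
qed

lemma not_convex_shifted_hyp2f1:
  fixes a b c :: real
  assumes a: "0 < a" "a < 1" and b: "1 < b" "b \<le> c" and c: "c < a + b"
    and quad: "c\<^sup>2 - 3 * c < a\<^sup>2 + b\<^sup>2 - 3 * a - 3 * b + 2"
  shows "\<not> convex_function (shifted_hyp2f1 a b c)"
proof
  assume cvx: "convex_function (shifted_hyp2f1 a b c)"
  have "a > 0" "b > 0" "c > 0" "a \<le> c" "b \<le> c" "a + b - c > 0"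
    using a b c by linarith+
  note convex_imp_angular_constant_nonneg[OF this cvx]
  moreover define s where "s = a + b - c"
  ultimately have "2 - a - b + (1 + s) / 2 + (a * b - 1 - s) / s \<ge> 0" and s: "s > 0"
    using c by simp_all
  then have "0 \<le> (2 * s) * (2 - a - b + (1 + s) / 2 + (a * b - 1 - s) / s)"
    by (intro mult_nonneg_nonneg) auto
  also have "\<dots> = s * (2 * (2 - a - b) + (1 + s)) + 2 * (a * b - 1 - s)"
    using s by (simp add: field_simps)
  also have "\<dots> = c\<^sup>2 - 3 * c - (a\<^sup>2 + b\<^sup>2 - 3 * a - 3 * b + 2)"
    by (simp add: s_def power2_eq_square algebra_simps)
  finally show False using quad by simp
qed

text \<open>
  In terms of \<open>s = a + b - c\<close> the difference of the two sides is a convex quadratic polynomial. It is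
  negative at \<open>s = 0\<close>, where it is \<open>2 (a b - 1)\<close>, and at \<open>s = a\<close>, where it is \<open>- (1 - a) (2 - a)\<close>; and
  \<open>b \<le> c < a + b\<close> places \<open>s\<close> between 0 and \<open>a\<close>.
\<close>

lemma quad_small_product:
  fixes a b c :: real
  assumes a: "0 < a" "a < 1" and b: "1 < b" "b \<le> c" and ab: "a * b < 1" and c: "c < a + b"
  shows "c\<^sup>2 - 3 * c < a\<^sup>2 + b\<^sup>2 - 3 * a - 3 * b + 2"
proof -
  have "a * (c\<^sup>2 - 3 * c - (a\<^sup>2 + b\<^sup>2 - 3 * a - 3 * b + 2)) =
      - (a * ((c - b) * (a + b - c))) - (a + b - c) * ((1 - a) * (2 - a)) - 2 * ((c - b) * (1 - a * b))"
    by (simp add: power2_eq_square algebra_simps)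
  also have "\<dots> < 0"
  proof -
    have "(a + b - c) * ((1 - a) * (2 - a)) > 0" using a c by (intro mult_pos_pos) auto
    moreover have "a * ((c - b) * (a + b - c)) \<ge> 0" "(c - b) * (1 - a * b) \<ge> 0"
      using a b c ab by (auto intro!: mult_nonneg_nonneg)
    ultimately show ?thesis by linarith
  qed
  finally show ?thesis using a by (simp add: mult_less_0_iff)
qed

text \<open>
  The claim says that \<open>c\<close> lies strictly between the roots of \<open>c\<^sup>2 - 3 c = a\<^sup>2 + b\<^sup>2 - 3 a - 3 b + 2\<close>. The
  hypothesis is the upper bound; the lower bound comes from \<open>b \<le> c\<close>, because the discriminant exceeds
  \<open>(2 b - 3)\<^sup>2\<close> by \<open>4 (1 - a) (2 - a)\<close>.
\<close>

lemma quad_large_product: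
  fixes a b c :: real
  assumes a: "0 < a" "a < 1" and b: "1 < b" "b \<le> c"
    and c: "c < (3 + sqrt (9 + 4 * (a\<^sup>2 + b\<^sup>2 - 3 * a - 3 * b + 2))) / 2"
  shows "c\<^sup>2 - 3 * c < a\<^sup>2 + b\<^sup>2 - 3 * a - 3 * b + 2"
proof -
  define D where "D = 9 + 4 * (a\<^sup>2 + b\<^sup>2 - 3 * a - 3 * b + 2)"
  have "D - (2 * b - 3)\<^sup>2 = 4 * ((1 - a) * (2 - a))"
    by (simp add: D_def power2_eq_square algebra_simps)
  also have "\<dots> > 0" using a by simp
  finally have D: "(2 * b - 3)\<^sup>2 < D" by simp
  then have "\<bar>2 * b - 3\<bar> < sqrt D" by (intro real_less_rsqrt) simp
  then have "\<bar>2 * c - 3\<bar> < sqrt D"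
    using c b unfolding D_def[symmetric] by (simp add: abs_less_iff)
  then have "(2 * c - 3)\<^sup>2 < (sqrt D)\<^sup>2"
    by (metis abs_ge_zero power2_abs power_strict_mono zero_less_numeral)
  also have "(sqrt D)\<^sup>2 = D" using D by (intro real_sqrt_pow2) (smt (verit) zero_le_power2)
  finally show ?thesis by (simp add: D_def power2_eq_square algebra_simps)
qed

theorem corollary1p10:
  shows
    "(\<forall>a b c :: real.
        0 < a \<and> a < 1 \<and> 0 < b \<and> b < 1 \<and> 1 + a + b - a * b \<le> c
        \<longrightarrow> convex_function (shifted_hyp2f1 a b c))
     \<and>
     (\<forall>a b c :: real.
        0 < a \<and> a < 1 \<and> 1 < b \<and> b \<le> c \<and>
        ((a * b < 1 \<and> c < a + b) \<or>
         (a * b > 1 \<and>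
          c < min (1 + a + b - a * b)
                  ((3 + sqrt (9 + 4 * (a\<^sup>2 + b\<^sup>2 - 3 * a - 3 * b + 2))) / 2)))
        \<longrightarrow> \<not> convex_function (shifted_hyp2f1 a b c))"
proof (intro conjI allI impI)
  fix a b c :: real
  assume "0 < a \<and> a < 1 \<and> 0 < b \<and> b < 1 \<and> 1 + a + b - a * b \<le> c"
  then show "convex_function (shifted_hyp2f1 a b c)"
    by (intro convex_shifted_hyp2f1) simp_all
next
  fix a b c :: real
  let ?Q = "a\<^sup>2 + b\<^sup>2 - 3 * a - 3 * b + 2"
  assume asm: "0 < a \<and> a < 1 \<and> 1 < b \<and> b \<le> c \<and>
    ((a * b < 1 \<and> c < a + b) \<or>
     (a * b > 1 \<and> c < min (1 + a + b - a * b) ((3 + sqrt (9 + 4 * ?Q)) / 2)))"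
  then have ab: "0 < a" "a < 1" "1 < b" "b \<le> c" by simp_all
  from asm consider "a * b < 1" "c < a + b"
    | "a * b > 1" "c < 1 + a + b - a * b" "c < (3 + sqrt (9 + 4 * ?Q)) / 2"
    by auto
  then show "\<not> convex_function (shifted_hyp2f1 a b c)"
  proof cases
    case 1
    then show ?thesis
      by (intro not_convex_shifted_hyp2f1[OF ab] quad_small_product[OF ab])
  next
    case 2
    then have "c < a + b" by linarith
    then show ?thesis
      using 2(3) by (intro not_convex_shifted_hyp2f1[OF ab] quad_large_product[OF ab])
  qed
qed

end
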